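(* Let $n,k,d,t$ be integers with $d\ge 2$, $t\ge 1$, $k\ge t+d-1$ and $n>\left(\frac{t+d+1}{2}\right)(k-t-d+3)$. If $\mathcal{F}\subseteq\binom{[n]}{k}$ is a nontrivial $d$-wise $t$-intersecting family, then $$|\mathcal{F}|\le\max\left\{|\mathcal{H}(n,k,t+d-1)|,\ |\mathcal{A}(n,k,t+d-1)|\right\}.$$ Furthermore, equality holds only if $\mathcal{F}$ is isomorphic to either $\mathcal{A}(n,k,t+d-1)$ or $\mathcal{H}(n,k,t+d-1)$.
   Context: Notation: $[n]=\{1,\dots,n\}$, $[a,b]=\{a,a+1,\dots,b\}$, and $\binom{[n]}{k}$ is the set of all $k$-element subsets of $[n]$. A family $\mathcal{F}\subseteq 2^{[n]}$ is $d$-wise $t$-intersecting if $|F_1\cap\cdots\cap F_d|\ge t$ for all $F_1,\dots,F_d\in\mathcal{F}$; it is nontrivial $d$-wise $t$-intersecting if in addition $|\bigcap_{F\in\mathcal{F}}F|<t$. Two families of subsets of $[n]$ are isomorphic if one is the image of the other under a permutation of $[n]$. For a positive integer $e$, define $$\mathcal{A}(n,k,e)=\left\{A\in\binom{[n]}{k}: |A\cap[e+1]|\ge e\right\},$$ $$\mathcal{H}(n,k,e)=\left\{A\in\binom{[n]}{k}: [e-1]\subset A,\ A\cap[e,k+1]\ne\emptyset\right\}\cup\left\{[k+1]\setminus\{i\}: i\in[e-1]\right\}.$$ *)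

theory Defs
  imports Complex_Main "HOL-Library.Ramsey" "HOL-Combinatorics.Permutations"
begin

(* The sets F_1, ..., F_d need not be distinct. *)
definition wise_intersecting :: "nat \<Rightarrow> nat \<Rightarrow> nat set set \<Rightarrow> bool" where
  "wise_intersecting d t \<F> \<longleftrightarrow>
     (\<forall>F. (\<forall>i\<in>{1..d}. F i \<in> \<F>) \<longrightarrow> t \<le> card (\<Inter>i\<in>{1..d}. F i))"

(* The intersection is taken inside the ground set {1..n}. This matters only for the empty
   family, for which the Isabelle intersection is the infinite set UNIV, of cardinality 0. *)
definition nontrivial_wise_intersecting :: "nat \<Rightarrow> nat \<Rightarrow> nat \<Rightarrow> nat set set \<Rightarrow> bool" where
  "nontrivial_wise_intersecting n d t \<F> \<longleftrightarrow>
     wise_intersecting d t \<F> \<and> card ({1..n} \<inter> \<Inter>\<F>) < t"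

definition isomorphic_families :: "nat \<Rightarrow> nat set set \<Rightarrow> nat set set \<Rightarrow> bool" where
  "isomorphic_families n \<F> \<G> \<longleftrightarrow> (\<exists>\<pi>. \<pi> permutes {1..n} \<and> \<F> = (\<lambda>A. \<pi> ` A) ` \<G>)"

definition family_A :: "nat \<Rightarrow> nat \<Rightarrow> nat \<Rightarrow> nat set set" where
  "family_A n k e = {A \<in> nsets {1..n} k. e \<le> card (A \<inter> {1..e + 1})}"

(* Intended for e \<ge> 1, so that e - 1 is not truncated. *)
definition family_H :: "nat \<Rightarrow> nat \<Rightarrow> nat \<Rightarrow> nat set set" where
  "family_H n k e =
     {A \<in> nsets {1..n} k. {1..e - 1} \<subseteq> A \<and> A \<inter> {e..k + 1} \<noteq> {}}
     \<union> {{1..k + 1} - {i} | i. i \<in> {1..e - 1}}"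

end

theory Submission
  imports Defs
begin

text \<open>The theorem reduces to a statement about pairwise intersections. If two members of a nontrivial
\<open>d\<close>-wise \<open>t\<close>-intersecting family met in fewer than \<open>t + d - 2\<close> points, then each of \<open>d - 2\<close> further
members could be chosen to remove a point from the intersection as long as at least \<open>t\<close> points are
left, because fewer than \<open>t\<close> points lie in all members; the \<open>d\<close> members together would meet in fewer
than \<open>t\<close> points. So with \<open>s = t + d - 2\<close> it remains to determine the largest \<open>s\<close>-intersecting families of
\<open>k\<close>-sets without \<open>s\<close> common points, for \<open>2 n > (s + 3) (k - s + 1)\<close>. In what follows \<open>s\<close> is written \<open>t\<close>.

Both extremal families belong to one series. For disjoint \<open>T\<close> and \<open>L\<close> with \<open>card T = t\<close> let
\<open>core_family n k T L\<close> consist of the \<open>k\<close>-sets that contain \<open>T\<close> and meet \<open>L\<close>, and of those that contain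
\<open>L\<close> and miss at most one point of \<open>T\<close>. Up to isomorphism, \<open>card L = 2\<close> gives \<open>family_A n k (t + 1)\<close> and
\<open>card L = k - t + 1\<close> gives \<open>family_H n k (t + 1)\<close>. Once enlarging \<open>L\<close> does not lower the size, enlarging it further
raises it, so only the two ends of the series can be maximum (\<open>maximum_in_core_family\<close>). It
therefore suffices to place a maximum family inside some \<open>core_family n k T L\<close>.

Assume first that the maximum family is stable under all compressions \<open>v\<close> to \<open>u\<close> with \<open>u < v\<close>. Following
the generating set method of Ahlswede and Khachatrian, let \<open>p\<close> be least such that any two members
meet in at least \<open>t\<close> points of \<open>{1..p}\<close>. By maximality, membership of a set depends only on its trace
on \<open>{1..p}\<close>. As \<open>p\<close> is least, two traces \<open>E\<close>, \<open>E'\<close> meet in exactly \<open>t\<close> points, one of which is \<open>p\<close>, and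
by stability they cover \<open>{1..p}\<close>, so that their sizes add up to \<open>p + t\<close>. If the sizes differ, one may
delete \<open>p\<close> from all the traces of the one size that need it and discard the traces of the other size,
or do the same with the roles exchanged; one of the two trades enlarges the family (\<open>trade_gain\<close>).
If the sizes agree and exceed \<open>t + 1\<close>, averaging yields a point \<open>m\<close> missed by many of these traces, and deleting \<open>p\<close>
from the traces that miss \<open>m\<close> enlarges the family; this is where the bound on \<open>n\<close> is needed in full
(\<open>equal_size_gain\<close>). As the family is maximum, the enlarged one has lost nontriviality,
and this can happen only if one of \<open>E\<close>, \<open>E'\<close> has \<open>t + 1\<close> points. So one of them has \<open>t + 1\<close> points in
every case, and \<open>p \<le> k + 1\<close>; from this it follows that the family lies in \<open>core_family n k {1..t} {t + 1..p}\<close>.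

A compression may destroy nontriviality. If the compression of \<open>j\<close> to \<open>i\<close> does, then all members
contain a fixed set of \<open>t - 1\<close> points and meet \<open>{i, j}\<close>. The same argument then applies with
compressions restricted to the remaining points: the two kinds of members that contain only one of
\<open>i\<close> and \<open>j\<close> take the place of the two sizes (\<open>hinged_maximum_in_core_family\<close>).

For the uniqueness one must return from a compressed family to the original one. If compressing a
\<open>t\<close>-intersecting family yields \<open>\<G> = core_family n k T L\<close>, then each member of \<open>\<G>\<close> that could have
arisen by a move either did or did not, and two such members that meet in exactly \<open>t\<close> points must
have made the same choice. The graph of these tight pairs is connected, by a connectivity property
of Kneser graphs, so the choice is the same throughout and the original family is \<open>\<G>\<close> or its image
under the transposition of \<open>i\<close> and \<open>j\<close> (\<open>shift_preimage\<close>). Induction on the sum of all elements of all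
members completes the argument.\<close>

section \<open>Compressions\<close>

definition replace :: "'a \<Rightarrow> 'a \<Rightarrow> 'a set \<Rightarrow> 'a set" where
  "replace i j A = insert i (A - {j})"

definition shift_set :: "'a set set \<Rightarrow> 'a \<Rightarrow> 'a \<Rightarrow> 'a set \<Rightarrow> 'a set" where
  "shift_set \<F> i j A =
     (if j \<in> A \<and> i \<notin> A \<and> replace i j A \<notin> \<F> then replace i j A else A)"

definition shift :: "'a \<Rightarrow> 'a \<Rightarrow> 'a set set \<Rightarrow> 'a set set" where
  "shift i j \<F> = shift_set \<F> i j ` \<F>"

definition intersecting :: "nat \<Rightarrow> 'a set set \<Rightarrow> bool" where
  "intersecting t \<F> \<longleftrightarrow> (\<forall>A\<in>\<F>. \<forall>B\<in>\<F>. t \<le> card (A \<inter> B))"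

text \<open>No set of exactly \<open>t\<close> points lies in all members. The common set is not confined to the ground set,
so the empty family counts as trivial.\<close>

definition nontrivial :: "nat \<Rightarrow> 'a set set \<Rightarrow> bool" where
  "nontrivial t \<F> \<longleftrightarrow> (\<nexists>T. card T = t \<and> (\<forall>A\<in>\<F>. T \<subseteq> A))"

definition stable :: "nat set \<Rightarrow> nat set set \<Rightarrow> bool" where
  "stable Y \<F> \<longleftrightarrow> (\<forall>u\<in>Y. \<forall>v\<in>Y. \<forall>A\<in>\<F>. u < v \<longrightarrow> v \<in> A \<longrightarrow> u \<notin> A \<longrightarrow> replace u v A \<in> \<F>)"

lemma intersectingD: "intersecting t \<F> \<Longrightarrow> A \<in> \<F> \<Longrightarrow> B \<in> \<F> \<Longrightarrow> t \<le> card (A \<inter> B)"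
  by (simp add: intersecting_def)

lemma stableD: "stable Y \<F> \<Longrightarrow> u \<in> Y \<Longrightarrow> v \<in> Y \<Longrightarrow> u < v \<Longrightarrow> A \<in> \<F> \<Longrightarrow> v \<in> A \<Longrightarrow> u \<notin> A
    \<Longrightarrow> replace u v A \<in> \<F>"
  by (simp add: stable_def)

lemma nontrivial_mono: "nontrivial t \<F> \<Longrightarrow> \<F> \<subseteq> \<G> \<Longrightarrow> nontrivial t \<G>"
  unfolding nontrivial_def by blast

lemma card_replace: "j \<in> A \<Longrightarrow> i \<notin> A \<Longrightarrow> finite A \<Longrightarrow> card (replace i j A) = card A"
  unfolding replace_def by (metis Diff_iff card_Suc_Diff1 card_insert_disjoint finite_Diff)

lemma replace_replace: "j \<in> A \<Longrightarrow> i \<notin> A \<Longrightarrow> replace j i (replace i j A) = A"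
  unfolding replace_def by blast

text \<open>In a family that is stable on \<open>Y\<close>, the part of a member inside \<open>Y' \<subseteq> Y\<close> can be pushed down
to an initial segment of \<open>Y'\<close> one element at a time, without touching the points outside \<open>Y'\<close>. This
produces the specific members on which the later arguments rest.\<close>

lemma stable_initial_segment:
  assumes "stable Y U" "Y' \<subseteq> Y" "S \<subseteq> Y'" "\<And>s y. s \<in> S \<Longrightarrow> y \<in> Y' - S \<Longrightarrow> s < y"
    and "E \<in> U" "finite E" "finite S" "card (E \<inter> Y') = card S"
  shows "(E - Y') \<union> S \<in> U"
  using assms(5-8)
proof (induction "card (S - E)" arbitrary: E)
  case 0
  then have "S \<subseteq> E" by simp
  then have "S \<subseteq> E \<inter> Y'" using assms(3) by blast
  then have "E \<inter> Y' = S" using 0 by (metis card_subset_eq finite_Int)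
  then have "(E - Y') \<union> S = E" by blast
  then show ?case using 0 by simp
next
  case (Suc m)
  then obtain s where s: "s \<in> S" "s \<notin> E"
    by (metis Diff_iff card.empty ex_in_conv nat.distinct(1))
  have "\<not> E \<inter> Y' \<subseteq> S"
  proof
    assume "E \<inter> Y' \<subseteq> S"
    then have "E \<inter> Y' = S" using Suc.prems by (metis card_subset_eq)
    then show False using s by blast
  qed
  then obtain v where v: "v \<in> E" "v \<in> Y'" "v \<notin> S" by blast
  let ?E = "replace s v E"
  have "s < v" using assms(4) s v by blast
  then have E: "?E \<in> U"
    using stableD[OF assms(1)] s v Suc.prems assms(2,3) by blast
  have "S - ?E = (S - E) - {s}" using v unfolding replace_def by blast
  then have 1: "m = card (S - ?E)" using Suc.hyps(2) s Suc.prems by simp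
  have "?E \<inter> Y' = replace s v (E \<inter> Y')" using s v assms(3) unfolding replace_def by blast
  then have 2: "card (?E \<inter> Y') = card S" using Suc.prems s v by (simp add: card_replace)
  have "finite ?E" using Suc.prems by (simp add: replace_def)
  then have "(?E - Y') \<union> S \<in> U" using Suc.hyps(1)[OF 1 E _ _ 2] Suc.prems by blast
  moreover have "?E - Y' = E - Y'" using s v assms(3) unfolding replace_def by blast
  ultimately show ?case by simp
qed

lemma inj_on_shift_set: "inj_on (shift_set \<F> i j) \<F>"
proof (rule inj_onI)
  fix A B assume A: "A \<in> \<F>" "B \<in> \<F>" "shift_set \<F> i j A = shift_set \<F> i j B"
  let ?m = "\<lambda>A. j \<in> A \<and> i \<notin> A \<and> replace i j A \<notin> \<F>"
  have m: "shift_set \<F> i j C = (if ?m C then replace i j C else C)" for C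
    by (simp add: shift_set_def)
  consider "?m A" "?m B" | "?m A" "\<not> ?m B" | "\<not> ?m A" "?m B" | "\<not> ?m A" "\<not> ?m B" by blast
  then show "A = B"
  proof cases
    case 1
    then have "shift_set \<F> i j A = replace i j A" "shift_set \<F> i j B = replace i j B" unfolding m by auto
    then have "replace i j A = replace i j B" using A(3) by simp
    then show ?thesis using 1 replace_replace by metis
  next
    case 2
    then have "shift_set \<F> i j A = replace i j A" "shift_set \<F> i j B = B" unfolding m by auto
    then have "replace i j A = B" using A(3) by simp
    then have "replace i j A \<in> \<F>" using A(2) by metis
    then show ?thesis using 2 by blast
  next
    case 3
    then have "shift_set \<F> i j A = A" "shift_set \<F> i j B = replace i j B" unfolding m by auto
    then have "A = replace i j B" using A(3) by simp
    then have "replace i j B \<in> \<F>" using A(1) by metis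
    then show ?thesis using 3 by blast
  next
    case 4
    then have "shift_set \<F> i j A = A" "shift_set \<F> i j B = B" unfolding m by auto
    then show ?thesis using A(3) by metis
  qed
qed

lemma card_shift: "card (shift i j \<F>) = card \<F>"
  unfolding shift_def by (rule card_image[OF inj_on_shift_set])

lemma shift_uniform:
  assumes "\<F> \<subseteq> nsets V k" "i \<in> V"
  shows "shift i j \<F> \<subseteq> nsets V k"
proof
  fix A assume "A \<in> shift i j \<F>"
  then obtain B where B: "B \<in> \<F>" "A = shift_set \<F> i j B" unfolding shift_def by blast
  have "B \<subseteq> V" "finite B" "card B = k" using B(1) assms(1) by (auto simp: nsets_def)
  then show "A \<in> nsets V k"
    using assms(2) B(2) by (auto simp: nsets_def shift_set_def card_replace) (auto simp: replace_def)
qed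

text \<open>Only a moved set \<open>A\<close> and a set \<open>B\<close> that stayed need care. If \<open>B\<close> stayed because its image was already
present, then \<open>A\<close> meets that image in as many points as the image of \<open>A\<close> meets \<open>B\<close>.\<close>

lemma shift_intersecting:
  assumes t: "intersecting t \<F>" and fin: "\<And>A. A \<in> \<F> \<Longrightarrow> finite A" and "i \<noteq> j"
  shows "intersecting t (shift i j \<F>)"
proof -
  let ?m = "\<lambda>A. j \<in> A \<and> i \<notin> A \<and> replace i j A \<notin> \<F>"
  have moved_fixed: "t \<le> card (replace i j A \<inter> B)"
    if A: "A \<in> \<F>" "?m A" and B: "B \<in> \<F>" "\<not> ?m B" for A B
  proof -
    consider "j \<notin> B" | "j \<in> B" "i \<in> B" | "j \<in> B" "i \<notin> B" "replace i j B \<in> \<F>" using B by blast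
    then show ?thesis
    proof cases
      case 1
      then have "A \<inter> B \<subseteq> replace i j A \<inter> B" unfolding replace_def by blast
      then show ?thesis using intersectingD[OF t A(1) B(1)] fin[OF B(1)]
        by (meson card_mono finite_Int le_trans)
    next
      case 2
      then have "replace i j A \<inter> B = replace i j (A \<inter> B)" unfolding replace_def by blast
      then show ?thesis using intersectingD[OF t A(1) B(1)] fin[OF B(1)] A 2
        by (simp add: card_replace)
    next
      case 3
      then have "replace i j A \<inter> B = A \<inter> replace i j B" using A assms(3) unfolding replace_def by blast
      then show ?thesis using intersectingD[OF t A(1) 3(3)] by simp
    qed
  qed
  have "t \<le> card (shift_set \<F> i j A \<inter> shift_set \<F> i j B)" if AB: "A \<in> \<F>" "B \<in> \<F>" for A B
  proof -
    consider "?m A" "?m B" | "?m A" "\<not> ?m B" | "\<not> ?m A" "?m B" | "\<not> ?m A" "\<not> ?m B" by blast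
    then show ?thesis
    proof cases
      case 1
      have "replace i j A \<inter> replace i j B = replace i j (A \<inter> B)" unfolding replace_def by blast
      then show ?thesis using 1 intersectingD[OF t AB] fin[OF AB(1)]
        by (simp add: shift_set_def card_replace)
    next
      case 2
      then have "shift_set \<F> i j A = replace i j A" "shift_set \<F> i j B = B"
        unfolding shift_set_def by auto
      then show ?thesis using moved_fixed[of A B] AB 2 by simp
    next
      case 3
      then have "shift_set \<F> i j B = replace i j B" "shift_set \<F> i j A = A"
        unfolding shift_set_def by auto
      then show ?thesis using moved_fixed[of B A] AB 3 by (simp add: Int_commute)
    next
      case 4
      then have "shift_set \<F> i j B = B" "shift_set \<F> i j A = A"
        unfolding shift_set_def by auto
      then show ?thesis using intersectingD[OF t AB] by simp
    qed
  qed
  then show ?thesis unfolding intersecting_def shift_def by blast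
qed

lemma sum_shift_less:
  assumes fin: "finite \<F>" "\<And>A. A \<in> \<F> \<Longrightarrow> finite A" and ij: "i < j" and ne: "shift i j \<F> \<noteq> \<F>"
  shows "(\<Sum>A\<in>shift i j \<F>. \<Sum>A) < (\<Sum>A\<in>\<F>. \<Sum>(A :: nat set))"
proof -
  have rep: "\<Sum>(replace i j A) < \<Sum>A" if "A \<in> \<F>" "j \<in> A" "i \<notin> A" for A
  proof -
    have "\<Sum>A = j + \<Sum>(A - {j})" using that fin(2) by (simp add: sum.remove)
    moreover have "\<Sum>(replace i j A) = i + \<Sum>(A - {j})"
      unfolding replace_def using that fin(2) by simp
    ultimately show ?thesis using ij by simp
  qed
  have ex: "\<exists>A\<in>\<F>. \<Sum>(shift_set \<F> i j A) < \<Sum>A"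
  proof (rule ccontr)
    assume c: "\<not> ?thesis"
    have "shift_set \<F> i j A = A" if "A \<in> \<F>" for A
    proof (cases "j \<in> A \<and> i \<notin> A \<and> replace i j A \<notin> \<F>")
      case True
      then have "shift_set \<F> i j A = replace i j A" by (simp add: shift_set_def)
      then show ?thesis using True c rep[of A] that by auto
    next
      case False
      then show ?thesis unfolding shift_set_def by auto
    qed
    then show False using ne unfolding shift_def by simp
  qed
  have le: "\<Sum>(shift_set \<F> i j A) \<le> \<Sum>A" if "A \<in> \<F>" for A
    using rep[OF that] unfolding shift_set_def by auto
  have "(\<Sum>A\<in>shift i j \<F>. \<Sum>A) = (\<Sum>A\<in>\<F>. \<Sum>(shift_set \<F> i j A))"
    unfolding shift_def by (subst sum.reindex[OF inj_on_shift_set]) simp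
  also have "\<dots> < (\<Sum>A\<in>\<F>. \<Sum>A)"
    using ex le by (intro sum_strict_mono_ex1[OF fin(1)]) auto
  finally show ?thesis .
qed

lemma stable_if_shift_eq:
  assumes "\<And>u v. u \<in> Y \<Longrightarrow> v \<in> Y \<Longrightarrow> u < v \<Longrightarrow> shift u v \<F> = \<F>"
  shows "stable Y \<F>"
  unfolding stable_def
proof (intro ballI impI)
  fix u v A assume *: "u \<in> Y" "v \<in> Y" "A \<in> \<F>" "u < v" "v \<in> A" "u \<notin> A"
  have "shift_set \<F> u v A \<in> \<F>" using assms * unfolding shift_def by blast
  then show "replace u v A \<in> \<F>" using * unfolding shift_set_def by (auto split: if_splits)
qed

section \<open>Trading members of a trace family\<close>

lemma card_fixed_trace:
  assumes "finite V" "W \<subseteq> V" "E \<subseteq> W" "card E \<le> k"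
  shows "card {A. A \<subseteq> V \<and> card A = k \<and> A \<inter> W = E} = (card V - card W) choose (k - card E)"
proof -
  have "finite W" by (rule finite_subset[OF assms(2,1)])
  moreover have "finite E" by (rule finite_subset[OF assms(3) \<open>finite W\<close>])
  ultimately have fin: "finite W" "finite E" by simp_all
  have "bij_betw (\<lambda>B. E \<union> B) {B. B \<subseteq> V - W \<and> card B = k - card E}
          {A. A \<subseteq> V \<and> card A = k \<and> A \<inter> W = E}"
  proof (rule bij_betwI[where g = "\<lambda>A. A - W"])
    show "(\<union>) E \<in> {B. B \<subseteq> V - W \<and> card B = k - card E} \<rightarrow> {A. A \<subseteq> V \<and> card A = k \<and> A \<inter> W = E}"
    proof
      fix B assume "B \<in> {B. B \<subseteq> V - W \<and> card B = k - card E}"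
      then have B: "B \<subseteq> V - W" "card B = k - card E" by auto
      have "finite B" using B(1) assms(1) by (meson finite_Diff finite_subset)
      moreover have "E \<inter> B = {}" using B(1) assms(3) by blast
      ultimately have "card (E \<union> B) = k" using B(2) fin assms(4) by (simp add: card_Un_disjoint)
      then show "E \<union> B \<in> {A. A \<subseteq> V \<and> card A = k \<and> A \<inter> W = E}" using B(1) assms by blast
    qed
    show "(\<lambda>A. A - W) \<in> {A. A \<subseteq> V \<and> card A = k \<and> A \<inter> W = E} \<rightarrow> {B. B \<subseteq> V - W \<and> card B = k - card E}"
    proof
      fix A assume A: "A \<in> {A. A \<subseteq> V \<and> card A = k \<and> A \<inter> W = E}"
      have "A - W = A - E" using A by blast
      then have "card (A - W) = k - card E"
        using A fin by (metis (mono_tags, lifting) Int_lower1 card_Diff_subset mem_Collect_eq)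
      then show "A - W \<in> {B. B \<subseteq> V - W \<and> card B = k - card E}" using A by blast
    qed
  qed (use assms in auto)
  then have "card {A. A \<subseteq> V \<and> card A = k \<and> A \<inter> W = E} = card {B. B \<subseteq> V - W \<and> card B = k - card E}"
    by (simp add: bij_betw_same_card)
  also have "\<dots> = (card V - card W) choose (k - card E)"
    using assms fin by (simp add: n_subsets card_Diff_subset)
  finally show ?thesis .
qed

definition cylinder :: "nat \<Rightarrow> nat \<Rightarrow> nat set \<Rightarrow> nat set set \<Rightarrow> nat set set" where
  "cylinder n k W U = {A \<in> nsets {1..n} k. A \<inter> W \<in> U}"

lemma nsets_eq: "nsets {1..n} k = {A. A \<subseteq> {1..n} \<and> card A = k}" for n :: nat
  unfolding nsets_def using finite_subset by blast

lemma finite_nsets_interval [simp]: "finite (nsets {1..n::nat} k)"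
  by (simp add: finite_imp_finite_nsets)

lemma finite_cylinder [simp]: "finite (cylinder n k W U)"
  unfolding cylinder_def by (rule finite_subset[OF _ finite_nsets_interval]) blast

lemma card_cylinder_uniform:
  assumes W: "W \<subseteq> {1..n}" and X: "X \<subseteq> Pow W" "\<And>E. E \<in> X \<Longrightarrow> card E = a" and "a \<le> k"
  shows "card (cylinder n k W X) = card X * ((n - card W) choose (k - a))"
proof -
  have finW: "finite W" using W by (rule finite_subset) simp
  then have fin: "finite X" using X(1) finite_subset by auto
  have "cylinder n k W X = (\<Union>E\<in>X. {A. A \<subseteq> {1..n} \<and> card A = k \<and> A \<inter> W = E})"
    unfolding cylinder_def nsets_eq by auto
  also have "card \<dots> = (\<Sum>E\<in>X. card {A. A \<subseteq> {1..n} \<and> card A = k \<and> A \<inter> W = E})"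
    using fin by (intro card_UN_disjoint) auto
  also have "\<dots> = (\<Sum>E\<in>X. (n - card W) choose (k - a))"
    using card_fixed_trace[OF _ W] X assms(4) by (intro sum.cong refl) auto
  finally show ?thesis by simp
qed

lemma intersecting_cylinder:
  assumes "intersecting t U"
  shows "intersecting t (cylinder n k W U)"
  unfolding intersecting_def
proof (intro ballI)
  fix A B assume AB: "A \<in> cylinder n k W U" "B \<in> cylinder n k W U"
  then have "t \<le> card ((A \<inter> W) \<inter> (B \<inter> W))"
    using intersectingD[OF assms] unfolding cylinder_def by blast
  also have "\<dots> \<le> card (A \<inter> B)"
    using AB by (intro card_mono) (auto simp: cylinder_def nsets_def)
  finally show "t \<le> card (A \<inter> B)" .
qed

text \<open>The recursion for binomial coefficients along a row, in a form without division.\<close>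

lemma binomial_Suc_weight: "Suc x * (N choose Suc x) = (N - x) * (N choose x)"
proof (cases "x \<le> N")
  case True
  show ?thesis
  proof (cases N)
    case (Suc M)
    then have "Suc x * (N choose Suc x) = N * ((N - 1) choose x)" by (simp only: Suc_times_binomial_eq diff_Suc_1 mult.commute)
    also have "\<dots> = (N - x) * (N choose x)" using binomial_absorb_comp[of N x] by simp
    finally show ?thesis .
  qed simp
qed (simp add: binomial_eq_0)

text \<open>Removing \<open>p\<close> from the members of \<open>X\<close> costs a point of intersection only with other members that
contain \<open>p\<close>. If those for which this would be fatal all lie in \<open>Y\<close>, then discarding \<open>Y\<close> repairs the
damage. As \<open>X\<close> is disjoint from \<open>Y\<close>, there is no fatal pair inside \<open>X\<close> either.\<close>

lemma intersecting_trade: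
  assumes U: "intersecting t U" and X: "X \<subseteq> U" and XY: "X \<inter> Y = {}"
    and conf: "\<And>E E'. E \<in> X \<Longrightarrow> E' \<in> U \<Longrightarrow> card (E \<inter> E' - {p}) < t \<Longrightarrow> E' \<in> Y"
  shows "intersecting t ((U - Y) \<union> (\<lambda>E. E - {p}) ` X)"
proof -
  have 1: "t \<le> card (E \<inter> E' - {p})" if "E \<in> X" "E' \<in> U - Y" for E E'
    using conf that by (meson DiffD1 DiffD2 not_less)
  have "t \<le> card ((E - {p}) \<inter> E')" if "E \<in> X" "E' \<in> U - Y" for E E'
    using 1[OF that] by (metis Int_Diff Int_commute)
  moreover have "t \<le> card (E' \<inter> (E - {p}))" if "E \<in> X" "E' \<in> U - Y" for E E'
    using 1[OF that] by (metis Int_Diff Int_commute)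
  moreover have "t \<le> card ((E - {p}) \<inter> (E' - {p}))" if "E \<in> X" "E' \<in> X" for E E'
  proof -
    have "E' \<in> U - Y" using that X XY by blast
    moreover have "(E - {p}) \<inter> (E' - {p}) = E \<inter> E' - {p}" by blast
    ultimately show ?thesis using 1[OF that(1)] by metis
  qed
  ultimately show ?thesis using U unfolding intersecting_def by auto
qed

lemma card_trade:
  assumes W: "W \<subseteq> {1..n}" and U: "U \<subseteq> Pow W" and X: "X \<subseteq> U" and Y: "Y \<subseteq> U"
    and p: "\<And>E. E \<in> X \<Longrightarrow> p \<in> E" "\<And>E. E \<in> X \<Longrightarrow> E - {p} \<notin> U"
    and a: "\<And>E. E \<in> X \<Longrightarrow> card E = a" and b: "\<And>E. E \<in> Y \<Longrightarrow> card E = b"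
    and "1 \<le> a" "a \<le> k" "b \<le> k"
  shows "card (cylinder n k W ((U - Y) \<union> (\<lambda>E. E - {p}) ` X)) + card Y * ((n - card W) choose (k - b))
       = card (cylinder n k W U) + card X * ((n - card W) choose Suc (k - a))"
proof -
  let ?X = "(\<lambda>E. E - {p}) ` X"
  have "finite W" using W by (rule finite_subset) simp
  then have finE: "finite E" if "E \<in> U" for E using that U finite_subset by blast
  have X1: "card E = a - 1" if "E \<in> ?X" for E
  proof -
    from that obtain E0 where "E0 \<in> X" "E = E0 - {p}" by blast
    then show ?thesis using a p(1) finE X by auto
  qed
  have X0: "?X \<subseteq> Pow W" using X U by blast
  have "inj_on (\<lambda>E. E - {p}) X"
    using p(1) by (intro inj_onI) (metis insert_Diff)
  then have cX: "card ?X = card X" by (rule card_image)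
  have "cylinder n k W ((U - Y) \<union> ?X) = cylinder n k W (U - Y) \<union> cylinder n k W ?X"
    unfolding cylinder_def by blast
  moreover have "cylinder n k W (U - Y) \<inter> cylinder n k W ?X = {}"
    unfolding cylinder_def using p(2) by auto
  ultimately have 1: "card (cylinder n k W ((U - Y) \<union> ?X))
      = card (cylinder n k W (U - Y)) + card (cylinder n k W ?X)"
    by (simp add: card_Un_disjoint)
  have "cylinder n k W U = cylinder n k W (U - Y) \<union> cylinder n k W Y"
    unfolding cylinder_def using Y by blast
  moreover have "cylinder n k W (U - Y) \<inter> cylinder n k W Y = {}"
    unfolding cylinder_def by auto
  ultimately have 2: "card (cylinder n k W U)
      = card (cylinder n k W (U - Y)) + card (cylinder n k W Y)"
    by (simp add: card_Un_disjoint)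
  have 3: "card (cylinder n k W Y) = card Y * ((n - card W) choose (k - b))"
    using Y U b assms by (intro card_cylinder_uniform) auto
  have 4: "card (cylinder n k W ?X) = card X * ((n - card W) choose (k - (a - 1)))"
    using cX card_cylinder_uniform[OF W X0 X1, of k] assms by simp
  have "k - (a - 1) = Suc (k - a)" using assms by simp
  then show ?thesis using 1 2 3 4 by simp
qed

text \<open>If neither of the two opposite trades pays, multiplying the two resulting inequalities cancels the
numbers of traces and leaves \<open>(N - x) (N - y) \<le> (x + 1) (y + 1)\<close> for the numbers \<open>x = k - a\<close> and
\<open>y = k - b\<close> of points outside the window of size \<open>n - N\<close>. This fails because \<open>x + y + 2 \<le> N\<close>.\<close>

lemma trade_gain:
  assumes W: "W \<subseteq> {1..n}" and U: "U \<subseteq> Pow W" and X: "X \<subseteq> U" "X \<noteq> {}" and Y: "Y \<subseteq> U" "Y \<noteq> {}"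
    and pX: "\<And>E. E \<in> X \<Longrightarrow> p \<in> E" "\<And>E. E \<in> X \<Longrightarrow> E - {p} \<notin> U"
    and pY: "\<And>E. E \<in> Y \<Longrightarrow> p \<in> E" "\<And>E. E \<in> Y \<Longrightarrow> E - {p} \<notin> U"
    and a: "\<And>E. E \<in> X \<Longrightarrow> card E = a" and b: "\<And>E. E \<in> Y \<Longrightarrow> card E = b"
    and "1 \<le> a" "a \<le> k" "1 \<le> b" "b \<le> k"
    and ab: "a + b = card W + t" and n: "2 * k + 2 \<le> n + t"
  shows "card (cylinder n k W U) < card (cylinder n k W ((U - Y) \<union> (\<lambda>E. E - {p}) ` X))
       \<or> card (cylinder n k W U) < card (cylinder n k W ((U - X) \<union> (\<lambda>E. E - {p}) ` Y))"
proof (rule ccontr)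
  assume no: "\<not> ?thesis"
  define N x y where "N = n - card W" and "x = k - a" and "y = k - b"
  have mn: "card W \<le> n" using W by (metis card_atLeastAtMost card_mono diff_Suc_1 finite_atLeastAtMost)
  have xyN: "x + y + 2 \<le> N" unfolding N_def x_def y_def using assms(14-) mn by linarith
  have finU: "finite U" using U W by (meson finite_Pow_iff finite_atLeastAtMost finite_subset)
  have pos: "0 < card X" "0 < card Y" using X Y finU by (auto simp: card_gt_0_iff intro: finite_subset)
  have "card X * (N choose Suc x) \<le> card Y * (N choose y)"
    using card_trade[OF W U X(1) Y(1) pX a b assms(13,14,16)] no unfolding N_def x_def y_def
    by linarith
  moreover have "card Y * (N choose Suc y) \<le> card X * (N choose x)"
    using card_trade[OF W U Y(1) X(1) pY b a assms(15,16,14)] no unfolding N_def x_def y_def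
    by linarith
  ultimately have "(card X * (N choose Suc x)) * (card Y * (N choose Suc y))
      \<le> (card Y * (N choose y)) * (card X * (N choose x))" by (rule mult_le_mono)
  then have le: "(N choose Suc x) * (N choose Suc y) \<le> (N choose x) * (N choose y)"
    using pos by (simp add: mult_ac)
  have bp: "0 < (N choose x) * (N choose y)" using xyN by simp
  have "(N - x) * (N choose x) * ((N - y) * (N choose y))
      = Suc x * (N choose Suc x) * (Suc y * (N choose Suc y))" by (simp only: binomial_Suc_weight)
  also have "\<dots> = Suc x * Suc y * ((N choose Suc x) * (N choose Suc y))" by (simp only: mult_ac)
  also have "\<dots> \<le> Suc x * Suc y * ((N choose x) * (N choose y))" using le by (rule mult_le_mono2)
  finally have "((N - x) * (N - y)) * ((N choose x) * (N choose y))
      \<le> (Suc x * Suc y) * ((N choose x) * (N choose y))" by (simp only: mult_ac)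
  then have "(N - x) * (N - y) \<le> Suc x * Suc y" using bp by (simp only: mult_le_cancel2)
  moreover have "Suc y * Suc x < (N - x) * (N - y)"
    using xyN by (intro mult_strict_mono) auto
  ultimately show False by (simp add: mult.commute)
qed

section \<open>The extremal families\<close>

text \<open>A common generalisation of the two extremal families. With \<open>card T = t\<close>, two points in \<open>L\<close> give the
sets that miss at most one point of \<open>T \<union> L\<close>, and \<open>k - t + 1\<close> points in \<open>L\<close> give the family of Hilton
and Milner type.\<close>

definition core_family :: "nat \<Rightarrow> nat \<Rightarrow> nat set \<Rightarrow> nat set \<Rightarrow> nat set set" where
  "core_family n k T L =
     {A \<in> nsets {1..n} k. (T \<subseteq> A \<and> A \<inter> L \<noteq> {}) \<or> (L \<subseteq> A \<and> card (T - A) \<le> 1)}"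

lemma exists_uniform_avoiding:
  assumes "Q \<subseteq> {1..n::nat}" "z \<notin> Q" "card Q \<le> k" "k < n"
  shows "\<exists>A. A \<subseteq> {1..n} \<and> card A = k \<and> Q \<subseteq> A \<and> z \<notin> A"
proof -
  have "k \<le> card ({1..n} - {z})" using assms(4) by (cases "z \<in> {1..n}") auto
  moreover have "Q \<subseteq> {1..n} - {z}" using assms by blast
  ultimately obtain A where "Q \<subseteq> A" "A \<subseteq> {1..n} - {z}" "card A = k"
    using exists_subset_between[of Q k "{1..n} - {z}"] assms(3) by auto
  then show ?thesis by blast
qed

text \<open>The range of parameters for the pairwise problem. The third condition says
\<open>n > (k - t + 1) (2 + (t - 1) / 2)\<close>. This is the lower end of the range in which, by the theorem of
Ahlswede and Khachatrian, the sets that miss at most one point of a fixed set of \<open>t + 2\<close> points form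
a largest \<open>t\<close>-intersecting family.\<close>

locale large_ground_set =
  fixes n k t :: nat
  assumes t_pos: "1 \<le> t" and t_less: "t < k" and n_large: "(t + 3) * (k - t + 1) < 2 * n"
begin

text \<open>The form of the bound under which trades between unequal sizes pay, the sizes of the core families
form a valley, and the Kneser graphs below are connected.\<close>

lemma n_ge: "2 * k + 2 \<le> n + t"
proof -
  obtain K where K: "k = t + Suc K" using t_less less_iff_Suc_add by auto
  obtain s where s: "t = Suc s" using t_pos by (cases t) auto
  have "t + 3 = s + 4" "k - t + 1 = K + 2" using K s by simp_all
  then have "(s + 4) * (K + 2) < 2 * n" using n_large by metis
  moreover have "(s + 4) * (K + 2) = s * K + 2 * s + 4 * K + 8" by (simp add: algebra_simps)
  ultimately have "2 * s + 4 * K + 8 < 2 * n" by linarith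
  then show ?thesis unfolding K s by simp
qed

definition admissible :: "nat set set \<Rightarrow> bool" where
  "admissible \<F> \<longleftrightarrow> \<F> \<subseteq> nsets {1..n} k \<and> intersecting t \<F> \<and> nontrivial t \<F>"

definition maximum :: "nat set set \<Rightarrow> bool" where
  "maximum \<F> \<longleftrightarrow> admissible \<F> \<and> (\<forall>\<G>. admissible \<G> \<longrightarrow> card \<G> \<le> card \<F>)"

definition core_pair :: "nat set \<Rightarrow> nat set \<Rightarrow> bool" where
  "core_pair T L \<longleftrightarrow> T \<subseteq> {1..n} \<and> L \<subseteq> {1..n} \<and> T \<inter> L = {} \<and> card T = t \<and>
     2 \<le> card L \<and> card L \<le> k - t + 1"

lemma core_pair_finite: "core_pair T L \<Longrightarrow> finite T \<and> finite L"
  unfolding core_pair_def by (auto intro: finite_subset)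

lemma maximum_superset:
  assumes "maximum \<F>" "\<F> \<subseteq> \<G>" "\<G> \<subseteq> nsets {1..n} k" "intersecting t \<G>"
  shows "\<G> = \<F>"
proof -
  have "admissible \<G>"
    using assms nontrivial_mono unfolding maximum_def admissible_def by blast
  then have "card \<G> \<le> card \<F>" using assms(1) unfolding maximum_def by blast
  moreover have "finite \<G>" by (rule finite_subset[OF assms(3) finite_nsets_interval])
  ultimately show ?thesis using assms(2) by (metis card_seteq)
qed

lemma core_family_intersecting:
  assumes "core_pair T L"
  shows "intersecting t (core_family n k T L)"
  unfolding intersecting_def
proof (intro ballI)
  fix A B assume AB: "A \<in> core_family n k T L" "B \<in> core_family n k T L"
  have fT: "finite T" and fL: "finite L" using core_pair_finite[OF assms] by auto
  have cT: "card T = t" and cL: "2 \<le> card L" and TL: "T \<inter> L = {}"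
    using assms unfolding core_pair_def by auto
  have fA: "finite A" "finite B" using AB unfolding core_family_def nsets_def by auto
  have miss: "t - 1 \<le> card (T \<inter> C)" if "card (T - C) \<le> 1" for C
  proof -
    have "t = card (T \<inter> C) + card (T - C)" using fT cT by (metis card_Int_Diff)
    then show ?thesis using that by simp
  qed
  have mixed: "t \<le> card (C \<inter> D)"
    if C: "T \<subseteq> C" "C \<inter> L \<noteq> {}" and D: "L \<subseteq> D" "card (T - D) \<le> 1" and fC: "finite C" for C D
  proof -
    obtain l where l: "l \<in> C" "l \<in> L" using C by blast
    have "insert l (T \<inter> D) \<subseteq> C \<inter> D" using C D l by blast
    then have "card (insert l (T \<inter> D)) \<le> card (C \<inter> D)" using fC by (intro card_mono) auto
    moreover have "l \<notin> T \<inter> D" using l TL by blast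
    ultimately show ?thesis using miss[OF D(2)] fT by simp
  qed
  consider "T \<subseteq> A" "A \<inter> L \<noteq> {}" "T \<subseteq> B" | "T \<subseteq> A" "A \<inter> L \<noteq> {}" "L \<subseteq> B" "card (T - B) \<le> 1"
    | "L \<subseteq> A" "card (T - A) \<le> 1" "T \<subseteq> B" "B \<inter> L \<noteq> {}"
    | "L \<subseteq> A" "card (T - A) \<le> 1" "L \<subseteq> B" "card (T - B) \<le> 1"
    using AB unfolding core_family_def by blast
  then show "t \<le> card (A \<inter> B)"
  proof cases
    case 1
    then have "T \<subseteq> A \<inter> B" by blast
    then show ?thesis using fA cT by (metis card_mono finite_Int)
  next
    case 2
    then show ?thesis using mixed fA by blast
  next
    case 3
    then show ?thesis using mixed[of B A] fA by (metis Int_commute)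
  next
    case 4
    have "T - (A \<inter> B) = (T - A) \<union> (T - B)" by blast
    then have "card (T - (A \<inter> B)) \<le> 2" using 4 card_Un_le[of "T - A" "T - B"] by simp
    moreover have "t = card (T \<inter> (A \<inter> B)) + card (T - (A \<inter> B))" using fT cT by (metis card_Int_Diff)
    moreover have "card (T \<inter> (A \<inter> B) \<union> L) = card (T \<inter> (A \<inter> B)) + card L"
      using fT fL TL by (intro card_Un_disjoint) auto
    moreover have "card (T \<inter> (A \<inter> B) \<union> L) \<le> card (A \<inter> B)"
      using 4 fA by (intro card_mono) auto
    ultimately show ?thesis using cL by linarith
  qed
qed

lemma core_family_nontrivial:
  assumes "core_pair T L"
  shows "nontrivial t (core_family n k T L)"
  unfolding nontrivial_def
proof
  assume "\<exists>S. card S = t \<and> (\<forall>A\<in>core_family n k T L. S \<subseteq> A)"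
  then obtain S where S: "card S = t" "\<And>A. A \<in> core_family n k T L \<Longrightarrow> S \<subseteq> A" by blast
  have fT: "finite T" and fL: "finite L" using core_pair_finite[OF assms] by auto
  have p: "card T = t" "2 \<le> card L" "card L \<le> k - t + 1" "T \<inter> L = {}" "T \<subseteq> {1..n}" "L \<subseteq> {1..n}"
    using assms unfolding core_pair_def by auto
  have kn: "k < n" using n_ge t_less by linarith
  obtain z where z: "z \<in> S" using S(1) t_pos by fastforce
  show False
  proof (cases "z \<in> T")
    case True
    have "card (T - {z} \<union> L) = t - 1 + card L"
      using True fT fL p by (subst card_Un_disjoint) auto
    then have "card (T - {z} \<union> L) \<le> k" using p t_pos t_less by linarith
    moreover have "z \<notin> T - {z} \<union> L" using True p by blast
    moreover have "T - {z} \<union> L \<subseteq> {1..n}" using p by blast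
    ultimately obtain A where A: "A \<subseteq> {1..n}" "card A = k" "T - {z} \<union> L \<subseteq> A" "z \<notin> A"
      using exists_uniform_avoiding[of "T - {z} \<union> L" n z k] kn by blast
    have "T - A = {z}" using A True by blast
    then have "A \<in> core_family n k T L" using A unfolding core_family_def nsets_eq by simp
    then show ?thesis using S(2) z A by blast
  next
    case False
    have "\<exists>l\<in>L. l \<noteq> z"
    proof (rule ccontr)
      assume "\<not> ?thesis"
      then have "L \<subseteq> {z}" by blast
      then have "card L \<le> card {z}" by (intro card_mono) auto
      then show False using p by simp
    qed
    then obtain l where l: "l \<in> L" "l \<noteq> z" by blast
    have "card (insert l T) \<le> k" using p fT t_less by (simp add: card_insert_if)
    moreover have "z \<notin> insert l T" "insert l T \<subseteq> {1..n}" using False l p by auto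
    ultimately obtain A where A: "A \<subseteq> {1..n}" "card A = k" "insert l T \<subseteq> A" "z \<notin> A"
      using exists_uniform_avoiding[of "insert l T" n z k] kn by blast
    then have "A \<in> core_family n k T L" using l unfolding core_family_def nsets_eq by blast
    then show ?thesis using S(2) z A by blast
  qed
qed

lemma core_family_admissible: "core_pair T L \<Longrightarrow> admissible (core_family n k T L)"
  using core_family_intersecting core_family_nontrivial
  unfolding admissible_def by (auto simp: core_family_def)

text \<open>Written additively to avoid subtraction: of the sets that contain \<open>T\<close>, those that are disjoint from
\<open>L\<close> are excluded, and for each of the \<open>t\<close> points of \<open>T\<close> the sets that miss just this point and contain
\<open>L\<close> are added.\<close>

lemma card_core_family:
  assumes "core_pair T L"
  shows "card (core_family n k T L) + ((n - t - card L) choose (k - t))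
       = ((n - t) choose (k - t)) + t * ((n - t - card L) choose (k - t + 1 - card L))"
proof -
  have fT: "finite T" and fL: "finite L" using core_pair_finite[OF assms] by auto
  have p: "card T = t" "2 \<le> card L" "card L \<le> k - t + 1" "T \<inter> L = {}" "T \<subseteq> {1..n}" "L \<subseteq> {1..n}"
    using assms unfolding core_pair_def by auto
  have cTL: "card (T \<union> L) = t + card L" using fT fL p by (simp add: card_Un_disjoint)
  let ?F = "\<lambda>W E. {A. A \<subseteq> {1..n} \<and> card A = k \<and> A \<inter> W = E}"
  let ?M = "\<Union>x\<in>T. ?F (T \<union> L) (T - {x} \<union> L)"
  have fin: "finite (?F W E)" for W E by (rule finite_subset[of _ "Pow {1..n}"]) auto
  let ?S = "{A. A \<subseteq> {1..n} \<and> card A = k \<and> T \<subseteq> A \<and> A \<inter> L \<noteq> {}}"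
  have split: "core_family n k T L = ?S \<union> ?M"
  proof (intro subset_antisym subsetI)
    fix A assume A: "A \<in> core_family n k T L"
    show "A \<in> ?S \<union> ?M"
    proof (cases "T \<subseteq> A")
      case True
      have "L \<noteq> {}" using p by auto
      then show ?thesis using A True unfolding core_family_def nsets_eq by auto
    next
      case False
      then obtain x where x: "x \<in> T - A" by blast
      have "card (T - A) \<le> 1" using False A unfolding core_family_def by blast
      then have "T - A = {x}" using x fT by (metis card_le_Suc0_iff_eq empty_iff finite_Diff is_singletonI' is_singleton_the_elem singletonD One_nat_def)
      then have "A \<inter> (T \<union> L) = T - {x} \<union> L" using False A unfolding core_family_def by blast
      then show ?thesis using A x unfolding core_family_def nsets_eq by blast
    qed
  next
    fix A assume "A \<in> ?S \<union> ?M"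
    then consider "A \<in> ?S" | x where "x \<in> T" "A \<in> ?F (T \<union> L) (T - {x} \<union> L)" by blast
    then show "A \<in> core_family n k T L"
    proof cases
      case 1
      then show ?thesis unfolding core_family_def nsets_eq by blast
    next
      case 2
      then have "T - A \<subseteq> {x}" "L \<subseteq> A" by blast+
      moreover from this have "card (T - A) \<le> 1" using card_mono[of "{x}" "T - A"] by simp
      ultimately show ?thesis using 2 unfolding core_family_def nsets_eq by blast
    qed
  qed
  have disj: "?S \<inter> ?M = {}" by (auto simp: set_eq_iff) (use p in blast)+
  have M: "card ?M = t * ((n - t - card L) choose (k - t + 1 - card L))"
  proof -
    have "card ?M = (\<Sum>x\<in>T. card (?F (T \<union> L) (T - {x} \<union> L)))"
      using fT fin p(4) by (intro card_UN_disjoint) auto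
    also have "\<dots> = (\<Sum>x\<in>T. (n - t - card L) choose (k - t + 1 - card L))"
    proof (intro sum.cong refl)
      fix x assume x: "x \<in> T"
      have c: "card (T - {x} \<union> L) = t - 1 + card L"
        using x fT fL p by (subst card_Un_disjoint) auto
      have "card (?F (T \<union> L) (T - {x} \<union> L)) =
        (card {1..n} - card (T \<union> L)) choose (k - card (T - {x} \<union> L))"
        using p t_less t_pos c by (intro card_fixed_trace) auto
      also have "card {1..n} - card (T \<union> L) = n - t - card L" using cTL by simp
      also have "k - card (T - {x} \<union> L) = k - t + 1 - card L" using c t_pos t_less by simp
      finally show "card (?F (T \<union> L) (T - {x} \<union> L)) = (n - t - card L) choose (k - t + 1 - card L)" .
    qed
    finally show ?thesis using p by simp
  qed
  have e: "?F T T = ?S \<union> ?F (T \<union> L) T" using p(4) by blast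
  have d: "?S \<inter> ?F (T \<union> L) T = {}" using p(4) by blast
  have fS: "finite ?S" by (rule finite_subset[of _ "Pow {1..n}"]) auto
  have S: "card (?F T T) = card ?S + card (?F (T \<union> L) T)"
    unfolding e by (rule card_Un_disjoint[OF fS fin d])
  have "card (?F T T) = (n - t) choose (k - t)"
    using card_fixed_trace[of "{1..n}" T T k] p t_less by simp
  moreover have "card (?F (T \<union> L) T) = (n - t - card L) choose (k - t)"
    using card_fixed_trace[of "{1..n}" "T \<union> L" T k] p t_less cTL by simp
  moreover have "card (core_family n k T L) = card ?S + card ?M"
    unfolding split using fin fT disj fS by (intro card_Un_disjoint) auto
  ultimately show ?thesis using S M by simp
qed

text \<open>Pascal's rule turns the difference of two consecutive members of the series into a difference of two
binomial coefficients with the same upper entry, one of them multiplied by \<open>t\<close>.\<close>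

lemma core_growth:
  assumes L: "core_pair T L" and L': "core_pair T (insert l L)" "l \<notin> L"
  shows "card (core_family n k T (insert l L)) + t * ((n - t - card L - 1) choose (k - t + 1 - card L))
       = card (core_family n k T L) + ((n - t - card L - 1) choose (k - t - 1))"
proof -
  define s N where "s = card L" and "N = n - t - s - 1"
  have c: "card (insert l L) = Suc s" using L'(2) core_pair_finite[OF L] s_def by simp
  have b: "2 \<le> s" "Suc s \<le> k - t + 1"
    using L L'(1) c unfolding core_pair_def s_def by auto
  have N: "n - t - s = Suc N" "n - t - Suc s = N" using b n_ge t_less unfolding N_def by linarith+
  obtain x where x: "k - t + 1 - s = Suc x" "k - t + 1 - Suc s = x"
    using b by (metis Suc_diff_Suc Suc_le_lessD)
  obtain m where m: "k - t = Suc m" "k - t - 1 = m" using t_less by (metis Suc_diff_Suc diff_Suc_1)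
  have 1: "card (core_family n k T L) + (Suc N choose Suc m) =
      ((n - t) choose (k - t)) + t * (Suc N choose Suc x)"
    using card_core_family[OF L] unfolding s_def[symmetric] N x unfolding m(1) .
  have 2: "card (core_family n k T (insert l L)) + (N choose Suc m) =
      ((n - t) choose (k - t)) + t * (N choose x)"
    using card_core_family[OF L'(1)] unfolding c N x unfolding m(1) .
  have "n - t - card L - 1 = N" using s_def N_def by simp
  moreover have "k - t + 1 - card L = Suc x" using x s_def by simp
  ultimately show ?thesis using 1 2 m(2) by (simp add: algebra_simps)
qed

text \<open>The left-hand side is multiplied by \<open>Suc x / N\<close> and the right-hand side by the larger factor
\<open>(N - m) / N\<close>.\<close>

lemma binomial_ratio_step:
  assumes "t * (N choose Suc x) \<le> (N choose m)" "m + Suc x < N"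
  shows "t * ((N - 1) choose x) < ((N - 1) choose m)"
proof -
  have "Suc (N - 1) = N" using assms(2) by simp
  then have "Suc x * (N choose Suc x) = N * ((N - 1) choose x)"
    using Suc_times_binomial_eq[of "N - 1" x] by (metis mult.commute)
  then have "t * ((N - 1) choose x) * N = t * Suc x * (N choose Suc x)"
    by (metis mult.assoc mult.commute)
  also have "\<dots> \<le> Suc x * (N choose m)" using assms(1) by (metis mult.assoc mult.commute mult_le_mono2)
  also have "\<dots> < (N - m) * (N choose m)" using assms(2) by (intro mult_strict_right_mono) auto
  also have "\<dots> = ((N - 1) choose m) * N" using binomial_absorb_comp[of N m] by (simp add: mult.commute)
  finally show ?thesis by simp
qed

text \<open>The sizes along the series of core families form a valley: by \<open>core_growth\<close> and \<open>binomial_ratio_step\<close>, if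
the step up to \<open>L\<close> is no loss, then the step beyond \<open>L\<close> is a gain. So a family in the interior of the
series is beaten by one of its two neighbours.\<close>

lemma maximum_in_core_family:
  assumes F: "maximum \<F>" "\<F> \<subseteq> core_family n k T L" and TL: "core_pair T L"
  shows "\<F> = core_family n k T L \<and> (card L = 2 \<or> card L = k - t + 1)"
proof
  show eq: "\<F> = core_family n k T L"
    using maximum_superset[OF F] core_family_admissible[OF TL] unfolding admissible_def by blast
  show "card L = 2 \<or> card L = k - t + 1"
  proof (rule ccontr)
    assume "\<not> ?thesis"
    then have L: "3 \<le> card L" "card L \<le> k - t" using TL unfolding core_pair_def by auto
    have fT: "finite T" and fL: "finite L" using core_pair_finite[OF TL] by auto
    have p: "card T = t" "T \<inter> L = {}" "T \<subseteq> {1..n}" "L \<subseteq> {1..n}" using TL unfolding core_pair_def by auto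
    have "L \<noteq> {}" using L by auto
    then obtain l where l: "l \<in> L" by blast
    have "card (T \<union> L) < card {1..n}"
      using L p fT fL n_ge by (subst card_Un_disjoint) auto
    then have "\<not> {1..n} \<subseteq> T \<union> L" using fT fL card_mono[of "T \<union> L" "{1..n}"] by auto
    then obtain l' where l': "l' \<in> {1..n}" "l' \<notin> T" "l' \<notin> L" by blast
    have low: "core_pair T (L - {l})" using TL l L fL unfolding core_pair_def by auto
    have high: "core_pair T (insert l' L)" using TL l' L fL unfolding core_pair_def by auto
    have il: "insert l (L - {l}) = L" using l by blast
    have cl: "card (L - {l}) = card L - 1" using l fL by simp
    define N where "N = n - t - card L"
    define x where "x = k - t - card L"
    have s: "n - t - card (L - {l}) - 1 = N" "k - t + 1 - card (L - {l}) = Suc (Suc x)"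
      "n - t - card L - 1 = N - 1" "k - t + 1 - card L = Suc x"
      using L cl unfolding N_def x_def by auto
    have "card (core_family n k T (L - {l})) \<le> card (core_family n k T L)"
      using F(1) core_family_admissible[OF low] unfolding maximum_def eq by blast
    then have "t * (N choose Suc (Suc x)) \<le> (N choose (k - t - 1))"
      using core_growth[OF low, of l] TL unfolding il s by simp
    moreover have "k - t - 1 + Suc (Suc x) < N" using L n_ge t_less unfolding N_def x_def by linarith
    ultimately have "t * ((N - 1) choose Suc x) < ((N - 1) choose (k - t - 1))"
      by (rule binomial_ratio_step)
    then have "card (core_family n k T L) < card (core_family n k T (insert l' L))"
      using core_growth[OF TL high l'(3)] unfolding s by simp
    then show False using F(1) core_family_admissible[OF high] unfolding maximum_def eq
      by (meson not_le)
  qed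
qed

end

section \<open>Undoing a compression\<close>

text \<open>The bipartite double cover of the Kneser graph of the \<open>m\<close>-subsets of \<open>V\<close> is connected. The predicates \<open>f\<close>
and \<open>g\<close> describe a set of vertices on the two sides that is a union of components. Two \<open>m\<close>-sets
that differ by exchanging one point have a common neighbour, since their union leaves at least \<open>m\<close>
points of \<open>V\<close>.\<close>

lemma kneser_double_connected:
  assumes fin: "finite V" and V: "2 * m + 1 \<le> card V"
    and fg: "\<And>P R. P \<subseteq> V \<Longrightarrow> R \<subseteq> V \<Longrightarrow> card P = m \<Longrightarrow> card R = m \<Longrightarrow> P \<inter> R = {} \<Longrightarrow> f P \<longleftrightarrow> g R"
    and PQ: "P \<subseteq> V" "card P = m" "Q \<subseteq> V" "card Q = m"
  shows "f P \<longleftrightarrow> f Q" "f P \<longleftrightarrow> g Q"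
proof -
  have disjoint: "\<exists>R. R \<subseteq> V - X \<and> card R = m" if "X \<subseteq> V" "card X \<le> m + 1" for X
  proof -
    have "m \<le> card (V - X)" using that V fin by (simp add: card_Diff_subset finite_subset)
    then show ?thesis using obtain_subset_with_card_n by metis
  qed
  have swap: "f P \<longleftrightarrow> f (replace b a P)"
    if "P \<subseteq> V" "card P = m" "a \<in> P" "b \<in> V" "b \<notin> P" for P a b
  proof -
    have finP: "finite P" using that(1) fin by (rule finite_subset)
    have "insert b P \<subseteq> V" "card (insert b P) \<le> m + 1" using that finP by auto
    then obtain R where R: "R \<subseteq> V - insert b P" "card R = m" using disjoint by blast
    have "f P \<longleftrightarrow> g R" using that R by (intro fg) auto
    moreover have "f (replace b a P) \<longleftrightarrow> g R"
      using that R finP by (intro fg) (auto simp: card_replace, auto simp: replace_def)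
    ultimately show ?thesis by simp
  qed
  have ff: "f P \<longleftrightarrow> f Q" if "P \<subseteq> V" "card P = m" "Q \<subseteq> V" "card Q = m" for P Q
    using that
  proof (induction "card (Q - P)" arbitrary: P)
    case 0
    have finP: "finite P" "finite Q" using 0 fin finite_subset by auto
    then have "Q \<subseteq> P" using 0 by simp
    then have "Q = P" using 0 finP by (metis card_subset_eq)
    then show ?case by simp
  next
    case (Suc r)
    have finP: "finite P" "finite Q" using Suc.prems fin finite_subset by auto
    have "Q - P \<noteq> {}" using Suc.hyps(2) by (metis card.empty nat.distinct(1))
    then obtain b where b: "b \<in> Q" "b \<notin> P" by blast
    have "\<not> P \<subseteq> Q" using b Suc.prems finP by (metis card_subset_eq)
    then obtain a where a: "a \<in> P" "a \<notin> Q" by blast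
    have c: "card (replace b a P) = m" using a b finP Suc.prems by (simp add: card_replace)
    have s: "replace b a P \<subseteq> V" using a b Suc.prems unfolding replace_def by blast
    have "Q - replace b a P = (Q - P) - {b}" using a b unfolding replace_def by blast
    then have "r = card (Q - replace b a P)" using Suc.hyps(2) b finP by simp
    from Suc.hyps(1)[OF this s c Suc.prems(3,4)] show ?case
      using swap[of P a b] a b Suc.prems by blast
  qed
  show "f P \<longleftrightarrow> f Q" using ff PQ by blast
  obtain R where R: "R \<subseteq> V - Q" "card R = m" using disjoint[of Q] PQ by auto
  have "f P \<longleftrightarrow> f R" using ff[of P R] PQ R by blast
  also have "\<dots> \<longleftrightarrow> g Q" using PQ R by (intro fg) auto
  finally show "f P \<longleftrightarrow> g Q" .
qed

text \<open>The members of a compressed family \<open>\<G>\<close> for which \<open>\<G>\<close> does not reveal whether they were moved from \<open>j\<close>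
to \<open>i\<close>.\<close>

definition movable :: "'a \<Rightarrow> 'a \<Rightarrow> 'a set set \<Rightarrow> 'a set set" where
  "movable i j \<G> = {A \<in> \<G>. i \<in> A \<and> j \<notin> A \<and> replace j i A \<notin> \<G>}"

text \<open>Connectedness of the graph on \<open>D\<close> in which sets with exactly \<open>t\<close> common points are adjacent.\<close>

definition tightly_connected :: "nat \<Rightarrow> 'a set set \<Rightarrow> bool" where
  "tightly_connected t D \<longleftrightarrow>
     (\<forall>S\<subseteq>D. (\<forall>A\<in>S. \<forall>C\<in>D. card (A \<inter> C) = t \<longrightarrow> C \<in> S) \<longrightarrow> S = {} \<or> S = D)"

lemma tightly_connected_empty [simp]: "tightly_connected t {}"
  unfolding tightly_connected_def by blast

lemma tightly_connectedI:
  assumes "\<And>S A C. (\<And>A C. A \<in> D \<Longrightarrow> C \<in> D \<Longrightarrow> card (A \<inter> C) = t \<Longrightarrow> A \<in> S \<longleftrightarrow> C \<in> S) \<Longrightarrow>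
    A \<in> D \<Longrightarrow> C \<in> D \<Longrightarrow> A \<in> S \<Longrightarrow> C \<in> S"
  shows "tightly_connected t D"
  unfolding tightly_connected_def
proof (intro allI impI)
  fix S assume S: "S \<subseteq> D" "\<forall>A\<in>S. \<forall>C\<in>D. card (A \<inter> C) = t \<longrightarrow> C \<in> S"
  have iff: "A \<in> S \<longleftrightarrow> C \<in> S" if "A \<in> D" "C \<in> D" "card (A \<inter> C) = t" for A C
    using S(2) that by (metis Int_commute)
  show "S = {} \<or> S = D" using assms[OF iff] S(1) by blast
qed

lemma image_transpose:
  "i \<in> A \<Longrightarrow> j \<notin> A \<Longrightarrow> transpose i j ` A = replace j i A"
  "i \<notin> A \<Longrightarrow> j \<in> A \<Longrightarrow> transpose i j ` A = replace i j A"
  "(i \<in> A \<longleftrightarrow> j \<in> A) \<Longrightarrow> transpose i j ` A = A"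
  by (auto simp: replace_def image_iff transpose_def)

text \<open>If \<open>A\<close> was in \<open>\<F>\<close> from the start and \<open>C\<close> was moved, then \<open>\<F>\<close> contains \<open>A\<close> and \<open>C\<close> with \<open>i\<close> replaced by
\<open>j\<close>, and these two have one common point fewer than \<open>A\<close> and \<open>C\<close>. Hence adjacent movable sets were both
moved or both not moved, and by connectedness this holds for all of them at once.\<close>

lemma shift_preimage:
  assumes t: "intersecting t \<F>" "1 \<le> t" and fin: "finite \<F>" "\<And>A. A \<in> \<F> \<Longrightarrow> finite A" and "i \<noteq> j"
    and conn: "tightly_connected t (movable i j (shift i j \<F>))"
  shows "\<F> = shift i j \<F> \<or> \<F> = (\<lambda>A. transpose i j ` A) ` shift i j \<F>"
proof -
  let ?G = "shift i j \<F>" let ?D = "movable i j ?G"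
  have unmoved: "replace j i A \<in> \<F>" if A: "A \<in> ?D" "A \<notin> \<F>" for A
  proof -
    obtain B where B: "B \<in> \<F>" "A = shift_set \<F> i j B" using A unfolding movable_def shift_def by blast
    then have "j \<in> B" "i \<notin> B" "A = replace i j B" using A(2) unfolding shift_set_def by (auto split: if_splits)
    then show ?thesis using B(1) by (simp add: replace_replace)
  qed
  have closed: "C \<in> \<F>" if A: "A \<in> ?D" "A \<in> \<F>" and C: "C \<in> ?D" and AC: "card (A \<inter> C) = t" for A C
  proof (rule ccontr)
    assume "C \<notin> \<F>"
    then have r: "replace j i C \<in> \<F>" using unmoved C by blast
    have "A \<inter> replace j i C = A \<inter> C - {i}" using A C \<open>i \<noteq> j\<close> unfolding movable_def replace_def by blast
    moreover have "i \<in> A \<inter> C" using A C unfolding movable_def by blast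
    moreover have "finite (A \<inter> C)" using A fin by blast
    ultimately have "card (A \<inter> replace j i C) = t - 1" using AC by simp
    then show False using intersectingD[OF t(1) A(2) r] t(2) by simp
  qed
  have "?D \<inter> \<F> = {} \<or> ?D \<inter> \<F> = ?D"
    using conn closed unfolding tightly_connected_def by (metis IntD1 IntD2 IntI inf_le1)
  then show ?thesis
  proof
    assume all: "?D \<inter> \<F> = ?D"
    have "shift_set \<F> i j A = A" if A: "A \<in> \<F>" for A
    proof (rule ccontr)
      assume ne: "\<not> ?thesis"
      then have m: "j \<in> A" "i \<notin> A" "replace i j A \<notin> \<F>" unfolding shift_set_def by (auto split: if_splits)
      have "A \<notin> ?G"
      proof
        assume "A \<in> ?G"
        then obtain B where B: "B \<in> \<F>" "A = shift_set \<F> i j B" unfolding shift_def by blast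
        have "B = A" using B m(2) unfolding shift_set_def replace_def by (auto split: if_splits)
        then show False using B(2) ne by simp
      qed
      moreover have "replace i j A \<in> ?G" using A m unfolding shift_def shift_set_def by (auto simp: image_iff)
      moreover have "replace j i (replace i j A) = A" using m by (simp add: replace_replace)
      ultimately have "replace i j A \<in> ?D" using \<open>i \<noteq> j\<close> unfolding movable_def by (simp add: replace_def)
      then show False using all m by blast
    qed
    then show ?thesis unfolding shift_def by simp
  next
    assume none: "?D \<inter> \<F> = {}"
    have "transpose i j ` A \<in> ?G" if A: "A \<in> \<F>" for A
    proof -
      consider "i \<in> A" "j \<notin> A" | "i \<notin> A" "j \<in> A" | "i \<in> A \<longleftrightarrow> j \<in> A" by blast
      then show ?thesis
      proof cases
        case 1
        then have "A \<in> ?G" using A unfolding shift_def shift_set_def by (auto simp: image_iff)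
        then have "replace j i A \<in> ?G" using none A 1 unfolding movable_def by blast
        then show ?thesis using 1 image_transpose(1)[of i A j] by simp
      next
        case 2
        have "replace i j A \<in> ?G"
        proof (cases "replace i j A \<in> \<F>")
          case True
          moreover have "shift_set \<F> i j (replace i j A) = replace i j A"
            using \<open>i \<noteq> j\<close> unfolding shift_set_def by (simp add: replace_def)
          ultimately show ?thesis unfolding shift_def by (metis imageI)
        next
          case False
          then have "shift_set \<F> i j A = replace i j A" using 2 unfolding shift_set_def by simp
          then show ?thesis using A unfolding shift_def by (metis imageI)
        qed
        then show ?thesis using 2 image_transpose(2)[of i A j] by simp
      next
        case 3
        then have "shift_set \<F> i j A = A" unfolding shift_set_def by auto
        then have "A \<in> ?G" using A unfolding shift_def by (metis imageI)
        then show ?thesis using 3 image_transpose(3)[of i A j] by simp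
      qed
    qed
    then have sub: "(\<lambda>A. transpose i j ` A) ` \<F> \<subseteq> ?G" by blast
    have "inj_on (\<lambda>A. transpose i j ` A) \<F>"
      by (intro inj_onI) (metis inj_image_eq_iff inj_transpose)
    then have "card ((\<lambda>A. transpose i j ` A) ` \<F>) = card ?G" by (simp add: card_image card_shift)
    moreover have "finite ?G" using fin(1) unfolding shift_def by simp
    ultimately have eq: "?G = (\<lambda>A. transpose i j ` A) ` \<F>" using sub by (metis card_subset_eq)
    have "(\<lambda>A. transpose i j ` A) ` ?G = \<F>" unfolding eq by (simp add: image_image)
    then show ?thesis by simp
  qed
qed

context large_ground_set
begin

text \<open>Two members \<open>A\<close> and \<open>C\<close> always admit points \<open>u\<close>, \<open>v\<close> of \<open>L\<close> such that each of them contains exactly one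
of the two. The members that contain \<open>T\<close> and exactly one of \<open>u\<close>, \<open>v\<close> form a double Kneser graph: the
point from \<open>{u, v}\<close> is the side, and the remaining \<open>k - t - 1\<close> points are the vertex.\<close>

lemma meeting_not_containing_tightly_connected:
  fixes T L :: "nat set" and j :: nat
  defines "D \<equiv> {A \<in> nsets {1..n} k. T \<subseteq> A \<and> j \<notin> A \<and> A \<inter> L \<noteq> {} \<and> \<not> L \<subseteq> A}"
  assumes T: "T \<subseteq> {1..n}" "card T = t" and L: "L \<subseteq> {1..n}" "T \<inter> L = {}" and j: "j \<notin> T" "j \<notin> L"
    and S: "\<And>A C. A \<in> D \<Longrightarrow> C \<in> D \<Longrightarrow> card (A \<inter> C) = t \<Longrightarrow> A \<in> S \<longleftrightarrow> C \<in> S"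
    and AC: "A \<in> D" "C \<in> D"
  shows "A \<in> S \<longleftrightarrow> C \<in> S"
proof -
  have finT: "finite T" using T(1) by (rule finite_subset) simp
  obtain u v where uv: "u \<in> L" "v \<in> L" "u \<in> A" "v \<notin> A" "u \<in> C \<and> v \<notin> C \<or> v \<in> C \<and> u \<notin> C"
  proof -
    obtain a a' where a: "a \<in> L" "a \<in> A" "a' \<in> L" "a' \<notin> A" using AC(1) unfolding D_def by blast
    obtain c c' where c: "c \<in> L" "c \<in> C" "c' \<in> L" "c' \<notin> C" using AC(2) unfolding D_def by blast
    show thesis using that a c by metis
  qed
  have uT: "u \<notin> T" "v \<notin> T" "u \<noteq> v" "u \<noteq> j" "v \<noteq> j" using uv L j by auto
  let ?V = "{1..n} - insert j (insert u (insert v T))"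
  have cV: "2 * (k - t - 1) + 1 \<le> card ?V"
  proof -
    have "card (insert j (insert u (insert v T))) = t + 3" using finT uT j T by simp
    then have "n \<le> card ?V + (t + 3)"
      using diff_card_le_card_Diff[of "insert j (insert u (insert v T))" "{1..n}"] finT by simp
    then show ?thesis using n_ge t_less by linarith
  qed
  let ?f = "\<lambda>x P. insert x (T \<union> P) \<in> S"
  have mem: "insert x (T \<union> P) \<in> D" if P: "P \<subseteq> ?V" "card P = k - t - 1" and x: "x = u \<or> x = v" for x P
  proof -
    have finP: "finite P" using P(1) by (rule finite_subset) simp
    have "card (T \<union> P) = k - 1" using P finP finT T t_less by (subst card_Un_disjoint) auto
    moreover have "x \<notin> T \<union> P" using x uT P by blast
    ultimately have "card (insert x (T \<union> P)) = k" using finT finP t_less by simp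
    moreover have "insert x (T \<union> P) \<subseteq> {1..n}" using P x uv L T by blast
    moreover have "j \<notin> insert x (T \<union> P)" using P x uT j by blast
    moreover have "insert x (T \<union> P) \<inter> L \<noteq> {}" using x uv by blast
    moreover have "\<not> L \<subseteq> insert x (T \<union> P)"
    proof -
      have "v \<notin> insert u (T \<union> P)" "u \<notin> insert v (T \<union> P)" using P(1) uT by blast+
      then show ?thesis using x uv(1,2) by blast
    qed
    ultimately show ?thesis unfolding D_def nsets_eq by blast
  qed
  have fg: "?f u P \<longleftrightarrow> ?f v R"
    if P: "P \<subseteq> ?V" "R \<subseteq> ?V" "card P = k - t - 1" "card R = k - t - 1" "P \<inter> R = {}" for P R
  proof -
    have "insert u (T \<union> P) \<inter> insert v (T \<union> R) = T" using P uT by blast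
    then show ?thesis using S mem P T by simp
  qed
  have dec: "E = insert x (T \<union> (E - insert x T)) \<and> E - insert x T \<subseteq> ?V \<and> card (E - insert x T) = k - t - 1"
    if E: "E \<in> D" "x \<in> E" and x: "x = u \<and> v \<notin> E \<or> x = v \<and> u \<notin> E" for E x
  proof -
    have "x \<notin> T" using x uT by blast
    moreover have "insert x T \<subseteq> E" using E unfolding D_def by blast
    moreover have "card E = k" using E unfolding D_def nsets_def by blast
    ultimately have "card (E - insert x T) = k - t - 1" using finT T by (simp add: card_Diff_subset)
    then show ?thesis using E x unfolding D_def nsets_eq by blast
  qed
  obtain P where P: "A = insert u (T \<union> P)" "P \<subseteq> ?V" "card P = k - t - 1"
    using dec[OF AC(1) uv(3)] uv(4) by blast
  note kneser = kneser_double_connected[of ?V _ "?f u" "?f v", OF _ cV fg, OF _ _ _ _ _ _ P(2,3)]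
  show ?thesis
  proof (cases "u \<in> C \<and> v \<notin> C")
    case True
    then obtain Q where Q: "C = insert u (T \<union> Q)" "Q \<subseteq> ?V" "card Q = k - t - 1"
      using dec[OF AC(2), of u] by blast
    show ?thesis unfolding P(1) Q(1) by (rule kneser(1)[OF _ _ _ _ _ _ Q(2,3)]) auto
  next
    case False
    then have "v \<in> C" "u \<notin> C" using uv(5) by auto
    then obtain Q where Q: "C = insert v (T \<union> Q)" "Q \<subseteq> ?V" "card Q = k - t - 1"
      using dec[OF AC(2), of v] by blast
    show ?thesis unfolding P(1) Q(1) by (rule kneser(2)[OF _ _ _ _ _ _ Q(2,3)]) auto
  qed
qed

lemma core_family_two:
  assumes "core_pair T L" "card L = 2"
  shows "core_family n k T L = {A \<in> nsets {1..n} k. card (T \<union> L - A) \<le> 1}"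
proof -
  have fin: "finite T" "finite L" using core_pair_finite assms by auto
  obtain a b where L: "L = {a, b}" "a \<noteq> b" using assms(2) by (meson card_2_iff)
  have ab: "a \<notin> T" "b \<notin> T" using assms(1) L unfolding core_pair_def by auto
  have "(T \<subseteq> A \<and> A \<inter> L \<noteq> {}) \<or> (L \<subseteq> A \<and> card (T - A) \<le> 1) \<longleftrightarrow> card (T \<union> L - A) \<le> 1" for A
  proof -
    have c: "card (T \<union> L - A) = card (T - A) + card (L - A)"
    proof -
      have "(T - A) \<inter> (L - A) = {}" using ab L by blast
      then show ?thesis using fin by (simp add: Un_Diff card_Un_disjoint)
    qed
    have "card (T - A) = 0 \<longleftrightarrow> T \<subseteq> A" using fin by auto
    moreover have "card (L - A) = 0 \<longleftrightarrow> L \<subseteq> A" using fin by auto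
    moreover have "card (L - A) \<le> 1 \<longleftrightarrow> A \<inter> L \<noteq> {}"
    proof (cases "a \<in> A \<or> b \<in> A")
      case True
      then have "L - A \<subseteq> {a} \<or> L - A \<subseteq> {b}" using L by blast
      then have "card (L - A) \<le> 1" using card_mono[of "{a}" "L - A"] card_mono[of "{b}" "L - A"] by auto
      then show ?thesis using True L by auto
    next
      case False
      then have "L - A = L" using L by blast
      then show ?thesis using assms(2) False L by auto
    qed
    ultimately show ?thesis unfolding c by linarith
  qed
  then show ?thesis unfolding core_family_def by simp
qed

text \<open>The family consists of the \<open>k\<close>-sets that miss at most one point of the set \<open>W\<close> of \<open>t + 2\<close> points. A
movable member misses exactly one point \<open>x\<close> of \<open>W\<close>, with \<open>x \<noteq> i\<close>. Members with different points
\<open>x\<close> are adjacent if and only if they are disjoint outside \<open>W\<close>, which is again a double Kneser graph for any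
two values of \<open>x\<close>.\<close>

lemma movable_core_two_tightly_connected:
  assumes TL: "core_pair T L" "card L = 2" and j: "j \<in> {1..n}"
  shows "tightly_connected t (movable i j (core_family n k T L))"
proof (rule tightly_connectedI)
  fix S A C
  define W where "W = T \<union> L"
  let ?D = "movable i j (core_family n k T L)"
  assume S: "\<And>A C. A \<in> ?D \<Longrightarrow> C \<in> ?D \<Longrightarrow> card (A \<inter> C) = t \<Longrightarrow> A \<in> S \<longleftrightarrow> C \<in> S"
    and AC: "A \<in> ?D" "C \<in> ?D" "A \<in> S"
  have fin: "finite T" "finite L" using core_pair_finite[OF TL(1)] by auto
  have W: "finite W" "card W = t + 2" "W \<subseteq> {1..n}"
    using TL fin unfolding W_def core_pair_def by (auto simp: card_Un_disjoint)
  have core: "core_family n k T L = {A \<in> nsets {1..n} k. card (W - A) \<le> 1}"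
    unfolding W_def using core_family_two[OF TL] .
  have D: "i \<in> W \<and> j \<notin> W \<and> (\<exists>x\<in>W - {i}. W - A = {x}) \<and> j \<notin> A \<and> A \<subseteq> {1..n} \<and> card A = k"
    if A: "A \<in> ?D" for A
  proof -
    have m: "A \<in> nsets {1..n} k" "card (W - A) \<le> 1" "i \<in> A" "j \<notin> A" "replace j i A \<notin> core_family n k T L"
      using A unfolding movable_def core by auto
    have "finite A" using m(1) unfolding nsets_def by blast
    then have "card (replace j i A) = k" using m by (simp add: card_replace nsets_def)
    moreover have "replace j i A \<subseteq> {1..n}" using m(1) j unfolding replace_def nsets_eq by blast
    ultimately have r: "\<not> card (W - replace j i A) \<le> 1" using m(5) unfolding core nsets_eq by blast
    have small: "\<not> W - replace j i A \<subseteq> W - A"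
      using r m(2) W(1) card_mono[of "W - A" "W - replace j i A"] by auto
    then have i: "i \<in> W" using m(3) unfolding replace_def by blast
    have x: "\<exists>x. W - A = {x}"
    proof (rule ccontr)
      assume "\<nexists>x. W - A = {x}"
      then have "card (W - A) = 0" using m(2) W(1) by (metis One_nat_def card_1_singletonE le_neq_implies_less less_one)
      then have "W - A = {}" using W(1) by simp
      then have "W - replace j i A \<subseteq> {i}" unfolding replace_def by blast
      then show False using r card_mono[of "{i}" "W - replace j i A"] by simp
    qed
    moreover have "j \<notin> W"
    proof
      assume "j \<in> W"
      then have "W - A = {j}" using x m(4) by (metis DiffI singletonD)
      then have "W - replace j i A \<subseteq> {i}" unfolding replace_def by blast
      then show False using r card_mono[of "{i}" "W - replace j i A"] by simp
    qed
    ultimately show ?thesis using i m unfolding nsets_eq by blast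
  qed
  have ij: "i \<in> W" "j \<notin> W" using D[OF AC(1)] by auto
  let ?V = "{1..n} - insert j W"
  let ?f = "\<lambda>x P. (W - {x}) \<union> P \<in> S"
  have cV: "2 * (k - t - 1) + 1 \<le> card ?V"
  proof -
    have "card (insert j W) = t + 3" using W ij by simp
    then have "n \<le> card ?V + (t + 3)"
      using diff_card_le_card_Diff[of "insert j W" "{1..n}"] W by simp
    then show ?thesis using n_ge t_less by linarith
  qed
  have mem: "(W - {x}) \<union> P \<in> ?D" if P: "P \<subseteq> ?V" "card P = k - t - 1" and x: "x \<in> W - {i}" for x P
  proof -
    have finP: "finite P" using P(1) by (rule finite_subset) simp
    have "(W - {x}) \<inter> P = {}" using P(1) by blast
    then have "card ((W - {x}) \<union> P) = k" using P W finP x t_less by (simp add: card_Un_disjoint)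
    moreover have "(W - {x}) \<union> P \<subseteq> {1..n}" using P W by blast
    moreover have "W - ((W - {x}) \<union> P) = {x}" using P x by blast
    moreover have "W - replace j i ((W - {x}) \<union> P) = {x, i}"
      using P x ij unfolding replace_def by blast
    moreover have "i \<in> (W - {x}) \<union> P" "j \<notin> (W - {x}) \<union> P" using P x ij by blast+
    ultimately show ?thesis using x unfolding movable_def core nsets_eq by simp
  qed
  have fg: "?f x P \<longleftrightarrow> ?f z R" if xz: "x \<in> W - {i}" "z \<in> W - {i}" "x \<noteq> z"
    and P: "P \<subseteq> ?V" "R \<subseteq> ?V" "card P = k - t - 1" "card R = k - t - 1" "P \<inter> R = {}" for x z P R
  proof -
    have "((W - {x}) \<union> P) \<inter> ((W - {z}) \<union> R) = W - {x, z}" using P by blast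
    moreover have "card (W - {x, z}) = t" using W xz by (simp add: card_Diff_subset)
    ultimately show ?thesis using S mem P xz by simp
  qed
  have dec: "\<exists>x P. x \<in> W - {i} \<and> E = (W - {x}) \<union> P \<and> P \<subseteq> ?V \<and> card P = k - t - 1" if E: "E \<in> ?D" for E
  proof -
    obtain x where x: "x \<in> W - {i}" "W - E = {x}" and E': "j \<notin> E" "E \<subseteq> {1..n}" "card E = k"
      using D[OF E] by blast
    have "E - W = E - (W - {x})" using x by blast
    moreover have "W - {x} \<subseteq> E" using x by blast
    ultimately have "card (E - W) = k - t - 1" using W x E' by (simp add: card_Diff_subset)
    moreover have "E = (W - {x}) \<union> (E - W)" using x by blast
    moreover have "E - W \<subseteq> ?V" using E' by blast
    ultimately show ?thesis using x by blast
  qed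
  obtain x P where P: "x \<in> W - {i}" "A = (W - {x}) \<union> P" "P \<subseteq> ?V" "card P = k - t - 1"
    using dec[OF AC(1)] by blast
  obtain y Q where Q: "y \<in> W - {i}" "C = (W - {y}) \<union> Q" "Q \<subseteq> ?V" "card Q = k - t - 1"
    using dec[OF AC(2)] by blast
  show "C \<in> S"
  proof (cases "x = y")
    case True
    have "card (W - {i, x}) = t" using W ij P(1) by (simp add: card_Diff_subset)
    then have "W - {i, x} \<noteq> {}" using t_pos by (metis card.empty not_one_le_zero)
    then obtain z where z: "z \<in> W - {i}" "x \<noteq> z" by blast
    have "?f x P \<longleftrightarrow> ?f x Q"
      by (rule kneser_double_connected(1)[OF _ cV fg[OF P(1) z] P(3,4) Q(3,4)]) simp_all
    then show ?thesis using AC(3) P Q True by simp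
  next
    case False
    have "?f x P \<longleftrightarrow> ?f y Q"
      by (rule kneser_double_connected(2)[OF _ cV fg[OF P(1) Q(1) False] P(3,4) Q(3,4)]) simp_all
    then show ?thesis using AC(3) P Q by simp
  qed
qed

text \<open>Such a set meets every \<open>T \<union> L - {x}\<close> with \<open>x \<in> T\<close> in exactly \<open>t\<close> points, so it links these sets to
those that contain \<open>T\<close>.\<close>

lemma exists_meeting_once:
  assumes TL: "core_pair T L" and u: "u \<in> L" and j: "j \<notin> T \<union> L" and L: "card L = k - t + 1"
  shows "\<exists>A. A \<in> nsets {1..n} k \<and> T \<subseteq> A \<and> A \<inter> L = {u} \<and> j \<notin> A"
proof -
  have fin: "finite T" "finite L" using core_pair_finite[OF TL] by auto
  have p: "T \<subseteq> {1..n}" "L \<subseteq> {1..n}" "T \<inter> L = {}" "card T = t" using TL unfolding core_pair_def by auto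
  let ?V = "{1..n} - insert j (T \<union> L)"
  have "card (insert j (T \<union> L)) = k + 2" using fin p L j t_less by (simp add: card_Un_disjoint)
  then have "n \<le> card ?V + (k + 2)"
    using diff_card_le_card_Diff[of "insert j (T \<union> L)" "{1..n}"] fin by simp
  then have "k - t - 1 \<le> card ?V" using n_ge t_less by linarith
  then obtain R where R: "R \<subseteq> ?V" "card R = k - t - 1" by (meson obtain_subset_with_card_n)
  have finR: "finite R" using R(1) by (rule finite_subset) simp
  have "card (insert u T \<union> R) = card (insert u T) + card R"
    using fin finR R u by (intro card_Un_disjoint) auto
  moreover have "u \<notin> T" using u p by blast
  ultimately have "card (insert u T \<union> R) = k" using fin p R t_less by simp
  moreover have "insert u T \<union> R \<subseteq> {1..n}" using p R u by blast
  moreover have "(insert u T \<union> R) \<inter> L = {u}" using p R u by blast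
  moreover have "j \<notin> insert u T \<union> R" using R u j by blast
  ultimately show ?thesis unfolding nsets_eq by blast
qed

lemma core_family_large:
  assumes TL: "core_pair T L" and L: "card L = k - t + 1"
  shows "core_family n k T L = {A \<in> nsets {1..n} k. T \<subseteq> A \<and> A \<inter> L \<noteq> {}} \<union> (\<lambda>x. T \<union> L - {x}) ` T"
    and "\<And>A. A \<in> nsets {1..n} k \<Longrightarrow> \<not> T \<union> L \<subseteq> A"
proof -
  have fin: "finite T" "finite L" using core_pair_finite[OF TL] by auto
  have p: "T \<subseteq> {1..n}" "L \<subseteq> {1..n}" "T \<inter> L = {}" "card T = t" using TL unfolding core_pair_def by auto
  have c: "card (T \<union> L) = k + 1" using fin p L t_less by (simp add: card_Un_disjoint)
  show big: "\<not> T \<union> L \<subseteq> A" if "A \<in> nsets {1..n} k" for A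
  proof
    assume "T \<union> L \<subseteq> A"
    then have "card (T \<union> L) \<le> card A" using that by (intro card_mono) (auto simp: nsets_def)
    then show False using c that unfolding nsets_def by simp
  qed
  show "core_family n k T L = {A \<in> nsets {1..n} k. T \<subseteq> A \<and> A \<inter> L \<noteq> {}} \<union> (\<lambda>x. T \<union> L - {x}) ` T"
    (is "_ = ?S \<union> ?M")
  proof (intro subset_antisym subsetI)
    fix A assume A: "A \<in> core_family n k T L"
    show "A \<in> ?S \<union> ?M"
    proof (cases "T \<subseteq> A \<and> A \<inter> L \<noteq> {}")
      case True
      then show ?thesis using A unfolding core_family_def by blast
    next
      case False
      then have m: "L \<subseteq> A" "card (T - A) \<le> 1" "A \<in> nsets {1..n} k" using A unfolding core_family_def by auto
      then obtain x where x: "x \<in> T - A" using big by blast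
      then have "T - A = {x}" using m(2) fin card_le_Suc0_iff_eq[of "T - A"] by auto
      then have sub: "T \<union> L - {x} \<subseteq> A" using m by blast
      have "card (T \<union> L - {x}) = card A" using c x fin m(3) by (simp add: nsets_def)
      then have "T \<union> L - {x} = A" using sub m(3) by (intro card_subset_eq) (auto simp: nsets_def)
      then show ?thesis using x by blast
    qed
  next
    fix A assume "A \<in> ?S \<union> ?M"
    then show "A \<in> core_family n k T L"
    proof
      assume "A \<in> ?M"
      then obtain x where x: "x \<in> T" "A = T \<union> L - {x}" by blast
      have "T - A = {x}" "L \<subseteq> A" using x p by auto
      moreover have "A \<in> nsets {1..n} k" using c x fin p unfolding nsets_eq by auto
      ultimately show ?thesis unfolding core_family_def by simp
    qed (auto simp: core_family_def)
  qed
qed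

text \<open>There are movable members only if \<open>i \<in> T\<close> and \<open>j \<in> L\<close>, or \<open>i \<in> T\<close> and \<open>j\<close> lies outside \<open>T \<union> L\<close>, or
\<open>i \<in> L\<close> and \<open>j\<close> lies outside \<open>T \<union> L\<close>. In the first case they are the sets of
\<open>meeting_not_containing_tightly_connected\<close> for \<open>L - {j}\<close>. In the second case the sets \<open>T \<union> L - {x}\<close> with
\<open>x \<noteq> i\<close> come in addition, each adjacent to every set that contains \<open>T\<close> and meets \<open>L\<close> once. In the
third case every such set with \<open>A \<inter> L = {i}\<close> is adjacent to every \<open>T \<union> L - {x}\<close>, and there are no other
movable members.\<close>

lemma movable_core_large_tightly_connected:
  assumes TL: "core_pair T L" and L: "card L = k - t + 1" and ij: "i \<noteq> j" "j \<in> {1..n}"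
  shows "tightly_connected t (movable i j (core_family n k T L))"
proof -
  let ?D = "movable i j (core_family n k T L)"
  have fin: "finite T" "finite L" using core_pair_finite[OF TL] by auto
  have p: "T \<subseteq> {1..n}" "L \<subseteq> {1..n}" "T \<inter> L = {}" "card T = t" "2 \<le> card L"
    using TL unfolding core_pair_def by auto
  note core = core_family_large(1)[OF TL L] and big = core_family_large(2)[OF TL L]
  have mem: "A \<in> ?D \<longleftrightarrow> i \<in> A \<and> j \<notin> A \<and>
      (A \<in> nsets {1..n} k \<and> T \<subseteq> A \<and> A \<inter> L \<noteq> {} \<or> (\<exists>x\<in>T. A = T \<union> L - {x})) \<and>
      \<not> (T \<subseteq> replace j i A \<and> replace j i A \<inter> L \<noteq> {}) \<and> (\<forall>x\<in>T. replace j i A \<noteq> T \<union> L - {x})" for A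
  proof -
    have "replace j i A \<in> nsets {1..n} k" if "A \<in> nsets {1..n} k" "i \<in> A" "j \<notin> A"
      using that ij(2) by (simp add: nsets_def card_replace) (auto simp: replace_def)
    moreover have "T \<union> L - {x} \<in> nsets {1..n} k" if "x \<in> T" for x
      using core that unfolding core_family_def by blast
    ultimately show ?thesis unfolding movable_def core by blast
  qed
  consider (out) "i \<notin> T \<union> L \<or> i \<in> T \<and> j \<in> T \<or> i \<in> L \<and> j \<in> T \<or> i \<in> L \<and> j \<in> L"
    | (TL) "i \<in> T" "j \<in> L" | (T) "i \<in> T" "j \<notin> T \<union> L" | (L) "i \<in> L" "j \<notin> T \<union> L" by blast
  then show ?thesis
  proof cases
    case out
    have "\<exists>l\<in>L. l \<noteq> i"
    proof (rule ccontr)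
      assume "\<not> ?thesis"
      then have "L \<subseteq> {i}" by blast
      then show False using p(5) card_mono[of "{i}" L] by simp
    qed
    have "A \<notin> ?D" for A
    proof
      assume "A \<in> ?D"
      then have m: "i \<in> A" "j \<notin> A"
        "A \<in> nsets {1..n} k \<and> T \<subseteq> A \<and> A \<inter> L \<noteq> {} \<or> (\<exists>x\<in>T. A = T \<union> L - {x})"
        "\<not> (T \<subseteq> replace j i A \<and> replace j i A \<inter> L \<noteq> {})" "\<forall>x\<in>T. replace j i A \<noteq> T \<union> L - {x}"
        unfolding mem by auto
      from m(3) show False
      proof (elim disjE conjE bexE)
        assume A: "T \<subseteq> A" "A \<inter> L \<noteq> {}"
        from out show False
        proof (elim disjE conjE)
          assume "i \<notin> T \<union> L"
          then show False using A m(4) unfolding replace_def by blast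
        next
          assume "i \<in> L" "j \<in> L"
          then show False using A m(4) p(3) unfolding replace_def by blast
        qed (use A m(2) in auto)
      next
        fix x assume x: "x \<in> T" "A = T \<union> L - {x}"
        from out show False
        proof (elim disjE conjE)
          assume "i \<in> T" "j \<in> T"
          have "x = j" using \<open>j \<in> T\<close> x(2) m(2) by blast
          then have "replace j i A = T \<union> L - {i}"
            using \<open>j \<in> T\<close> ij(1) unfolding x(2) replace_def by auto
          then show False using m(5) \<open>i \<in> T\<close> by blast
        next
          assume "i \<in> L" "j \<in> T"
          then have "T \<subseteq> replace j i A" "replace j i A \<inter> L = L - {i}" using x m(2) p(3) unfolding replace_def by blast+
          then show False using m(4) \<open>\<exists>l\<in>L. l \<noteq> i\<close> by blast
        next
          assume "i \<in> L" "j \<in> L"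
          then show False using x m(2) p(3) by blast
        qed (use x m(1) in blast)
      qed
    qed
    then have "?D = {}" by blast
    then show ?thesis by simp
  next
    case TL
    have D: "?D = {A \<in> nsets {1..n} k. T \<subseteq> A \<and> j \<notin> A \<and> A \<inter> (L - {j}) \<noteq> {} \<and> \<not> L - {j} \<subseteq> A}"
    proof (intro set_eqI)
      fix A
      have 1: "replace j i A = T \<union> L - {i}"
        if "A \<in> nsets {1..n} k" "T \<subseteq> A" "L - {j} \<subseteq> A" "j \<notin> A"
      proof -
        have "card (T \<union> L - {j}) = card A"
          using that fin p(3,4) L TL t_less by (simp add: card_Un_disjoint nsets_def)
        moreover have "T \<union> L - {j} \<subseteq> A" using that by blast
        ultimately have "T \<union> L - {j} = A" using that by (intro card_subset_eq) (auto simp: nsets_def)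
        then show ?thesis using TL p(3) unfolding replace_def by blast
      qed
      have 2: "replace j i A \<noteq> T \<union> L - {x}" if "\<not> L - {j} \<subseteq> A" "x \<in> T" for x
        using that p(3) TL unfolding replace_def by blast
      show "A \<in> ?D \<longleftrightarrow> A \<in> {A \<in> nsets {1..n} k. T \<subseteq> A \<and> j \<notin> A \<and> A \<inter> (L - {j}) \<noteq> {} \<and> \<not> L - {j} \<subseteq> A}"
      proof
        assume "A \<in> ?D"
        then have m: "i \<in> A" "j \<notin> A"
          "A \<in> nsets {1..n} k \<and> T \<subseteq> A \<and> A \<inter> L \<noteq> {} \<or> (\<exists>x\<in>T. A = T \<union> L - {x})"
          "\<forall>x\<in>T. replace j i A \<noteq> T \<union> L - {x}"
          unfolding mem by auto
        have "A \<noteq> T \<union> L - {x}" if "x \<in> T" for x using m(2) TL p(3) that by blast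
        then have A: "A \<in> nsets {1..n} k" "T \<subseteq> A" "A \<inter> L \<noteq> {}" using m(3) by auto
        moreover have "\<not> L - {j} \<subseteq> A" using 1[OF A(1,2) _ m(2)] m(4) TL(1) by blast
        moreover have "A \<inter> (L - {j}) \<noteq> {}" using A(3) m(2) by blast
        ultimately show "A \<in> {A \<in> nsets {1..n} k. T \<subseteq> A \<and> j \<notin> A \<and> A \<inter> (L - {j}) \<noteq> {} \<and> \<not> L - {j} \<subseteq> A}"
          using m(2) by simp
      next
        assume A: "A \<in> {A \<in> nsets {1..n} k. T \<subseteq> A \<and> j \<notin> A \<and> A \<inter> (L - {j}) \<noteq> {} \<and> \<not> L - {j} \<subseteq> A}"
        have "\<not> T \<subseteq> replace j i A" using TL ij(1) unfolding replace_def by blast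
        moreover have "i \<in> A" "A \<inter> L \<noteq> {}" using A TL by auto
        moreover have "\<forall>x\<in>T. replace j i A \<noteq> T \<union> L - {x}" using A 2 by simp
        ultimately show "A \<in> ?D" using A unfolding mem by simp
      qed
    qed
    have "T \<inter> (L - {j}) = {}" "L - {j} \<subseteq> {1..n}" "j \<notin> T" using p TL by auto
    then show ?thesis
      using meeting_not_containing_tightly_connected[OF p(1,4), of "L - {j}" j]
      unfolding D by (intro tightly_connectedI) blast
  next
    case T
    let ?E = "{A \<in> nsets {1..n} k. T \<subseteq> A \<and> j \<notin> A \<and> A \<inter> L \<noteq> {} \<and> \<not> L \<subseteq> A}"
    have D: "?D = ?E \<union> (\<lambda>x. T \<union> L - {x}) ` (T - {i})"
    proof (intro set_eqI iffI)
      fix A assume "A \<in> ?D"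
      then have m: "i \<in> A" "j \<notin> A"
          "A \<in> nsets {1..n} k \<and> T \<subseteq> A \<and> A \<inter> L \<noteq> {} \<or> (\<exists>x\<in>T. A = T \<union> L - {x})"
          unfolding mem by auto
      then show "A \<in> ?E \<union> (\<lambda>x. T \<union> L - {x}) ` (T - {i})" using big T by blast
    next
      fix A assume A: "A \<in> ?E \<union> (\<lambda>x. T \<union> L - {x}) ` (T - {i})"
      have "i \<in> A" "j \<notin> A" using A T by auto
      have r: "i \<notin> replace j i A" "j \<in> replace j i A" using ij(1) unfolding replace_def by auto
      have "\<not> T \<subseteq> replace j i A" "\<forall>x\<in>T. replace j i A \<noteq> T \<union> L - {x}" using r T by auto
      moreover have "A \<in> nsets {1..n} k \<and> T \<subseteq> A \<and> A \<inter> L \<noteq> {} \<or> (\<exists>x\<in>T. A = T \<union> L - {x})" using A by auto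
      ultimately show "A \<in> ?D" using \<open>i \<in> A\<close> \<open>j \<notin> A\<close> unfolding mem by simp
    qed
    have "L \<noteq> {}" using p by auto
    then obtain u where u: "u \<in> L" by blast
    obtain B where B: "B \<in> nsets {1..n} k" "T \<subseteq> B" "B \<inter> L = {u}" "j \<notin> B"
      using exists_meeting_once[OF assms(1) u T(2) L] by blast
    have BE: "B \<in> ?E" using B big by blast
    show ?thesis
    proof (rule tightly_connectedI)
      fix S A C assume S: "\<And>A C. A \<in> ?D \<Longrightarrow> C \<in> ?D \<Longrightarrow> card (A \<inter> C) = t \<Longrightarrow> A \<in> S \<longleftrightarrow> C \<in> S"
        and AC: "A \<in> ?D" "C \<in> ?D" "A \<in> S"
      have "A \<in> S \<longleftrightarrow> B \<in> S" if A: "A \<in> ?D" for A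
      proof -
        from A consider "A \<in> ?E" | x where "x \<in> T - {i}" "A = T \<union> L - {x}" unfolding D by blast
        then show ?thesis
        proof cases
          case 1
          have SE: "X \<in> S \<longleftrightarrow> Y \<in> S" if "X \<in> ?E" "Y \<in> ?E" "card (X \<inter> Y) = t" for X Y
            using S[OF _ _ that(3)] that(1,2) unfolding D by blast
          show ?thesis
            by (rule meeting_not_containing_tightly_connected[OF p(1,4,2,3) _ _ SE 1 BE]) (use T(2) in auto)
        next
          case 2
          have "A \<inter> B = insert u (T - {x})" using 2 B u p(3) by blast
          moreover have "u \<notin> T" using u p(3) by blast
          ultimately have "card (A \<inter> B) = t" using 2 fin p(4) t_pos by simp
          then show ?thesis using S A BE D by blast
        qed
      qed
      then show "C \<in> S" using AC by blast
    qed
  next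
    case L
    note cL = assms(2)
    have D: "?D = {A \<in> nsets {1..n} k. T \<subseteq> A \<and> A \<inter> L = {i} \<and> j \<notin> A} \<union> (\<lambda>x. T \<union> L - {x}) ` T" (is "_ = ?E \<union> ?M")
    proof (intro set_eqI iffI)
      fix A assume "A \<in> ?D"
      then have m: "i \<in> A" "j \<notin> A"
          "A \<in> nsets {1..n} k \<and> T \<subseteq> A \<and> A \<inter> L \<noteq> {} \<or> (\<exists>x\<in>T. A = T \<union> L - {x})"
          "\<not> (T \<subseteq> replace j i A \<and> replace j i A \<inter> L \<noteq> {})"
          unfolding mem by auto
      from m(3) show "A \<in> ?E \<union> ?M"
      proof (elim disjE conjE bexE)
        assume A: "A \<in> nsets {1..n} k" "T \<subseteq> A" "A \<inter> L \<noteq> {}"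
        have "T \<subseteq> replace j i A" using A L p(3) unfolding replace_def by blast
        then have "replace j i A \<inter> L = {}" using m(4) by blast
        then have "A \<inter> L = {i}" using L m(1) unfolding replace_def by blast
        then show ?thesis using A m by blast
      qed blast
    next
      fix A assume A: "A \<in> ?E \<union> ?M"
      have ji: "i \<in> A" "j \<notin> A" using A L p(3) by auto
      have r: "i \<notin> replace j i A" "j \<in> replace j i A" using ij(1) unfolding replace_def by auto
      have "\<not> (T \<subseteq> replace j i A \<and> replace j i A \<inter> L \<noteq> {})"
        using A
      proof
        assume "A \<in> ?E"
        then show ?thesis using L unfolding replace_def by blast
      next
        assume "A \<in> ?M"
        then show ?thesis using L unfolding replace_def by blast
      qed
      moreover have "\<forall>x\<in>T. replace j i A \<noteq> T \<union> L - {x}" using r L by blast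
      moreover have "A \<in> nsets {1..n} k \<and> T \<subseteq> A \<and> A \<inter> L \<noteq> {} \<or> (\<exists>x\<in>T. A = T \<union> L - {x})" using A by auto
      ultimately show "A \<in> ?D" using ji unfolding mem by simp
    qed
    obtain B where B: "B \<in> nsets {1..n} k" "T \<subseteq> B" "B \<inter> L = {i}" "j \<notin> B"
      using exists_meeting_once[OF assms(1) L cL] by blast
    have "T \<noteq> {}" using p t_pos by auto
    then obtain x0 where x0: "x0 \<in> T" by blast
    have i: "i \<notin> T" using L p(3) by blast
    have one: "card (E \<inter> M) = t" if E: "E \<in> ?E" and M: "M \<in> ?M" for E M
    proof -
      obtain x where x: "x \<in> T" "M = T \<union> L - {x}" using M by blast
      then have "E \<inter> M = insert i (T - {x})" using E p(3) i by blast
      then show ?thesis using x fin p(4) t_pos i by simp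
    qed
    show ?thesis
    proof (rule tightly_connectedI)
      fix S A C assume S: "\<And>A C. A \<in> ?D \<Longrightarrow> C \<in> ?D \<Longrightarrow> card (A \<inter> C) = t \<Longrightarrow> A \<in> S \<longleftrightarrow> C \<in> S"
        and AC: "A \<in> ?D" "C \<in> ?D" "A \<in> S"
      have EM: "E \<in> S \<longleftrightarrow> M \<in> S" if "E \<in> ?E" "M \<in> ?M" for E M
        using S[of E M] one[OF that] that unfolding D by blast
      have BE: "B \<in> ?E" using B by blast
      have M0: "T \<union> L - {x0} \<in> ?M" using x0 by blast
      have "X \<in> S \<longleftrightarrow> B \<in> S" if "X \<in> ?D" for X
      proof (cases "X \<in> ?E")
        case True
        then show ?thesis using EM[OF True M0] EM[OF BE M0] by blast
      next
        case False
        then have "X \<in> ?M" using that unfolding D by blast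
        then show ?thesis using EM[OF BE] by blast
      qed
      then show "C \<in> S" using AC by blast
    qed
  qed
qed

end

context large_ground_set
begin

lemma core_family_image_subset:
  assumes "\<pi> permutes {1..n}"
  shows "(\<lambda>A. \<pi> ` A) ` core_family n k T L \<subseteq> core_family n k (\<pi> ` T) (\<pi> ` L)"
proof
  fix B assume "B \<in> (\<lambda>A. \<pi> ` A) ` core_family n k T L"
  then obtain A where A: "A \<in> core_family n k T L" "B = \<pi> ` A" by blast
  have inj: "inj \<pi>" using assms by (rule permutes_inj)
  have "\<pi> ` A \<subseteq> \<pi> ` {1..n}" using A unfolding core_family_def nsets_eq by blast
  then have "\<pi> ` A \<subseteq> {1..n}" using assms by (simp add: permutes_image)
  moreover have "card (\<pi> ` A) = k"
    using A inj unfolding core_family_def nsets_def by (simp add: card_image inj_on_subset[OF inj])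
  moreover have "\<pi> ` T - \<pi> ` A = \<pi> ` (T - A)" using inj by (simp add: image_set_diff)
  moreover have "card (\<pi> ` (T - A)) = card (T - A)" using inj by (simp add: card_image inj_on_subset[OF inj])
  moreover have "\<pi> ` A \<inter> \<pi> ` L = \<pi> ` (A \<inter> L)" using inj by (simp add: image_Int)
  ultimately show "B \<in> core_family n k (\<pi> ` T) (\<pi> ` L)"
    using A unfolding core_family_def nsets_eq by auto
qed

lemma core_family_image:
  assumes "\<pi> permutes {1..n}"
  shows "core_family n k (\<pi> ` T) (\<pi> ` L) = (\<lambda>A. \<pi> ` A) ` core_family n k T L"
proof
  show "(\<lambda>A. \<pi> ` A) ` core_family n k T L \<subseteq> core_family n k (\<pi> ` T) (\<pi> ` L)"
    by (rule core_family_image_subset[OF assms])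
  have id: "inv \<pi> ` \<pi> ` X = X" "\<pi> ` inv \<pi> ` X = X" for X
    using permutes_inverses[OF assms] by (simp_all add: image_image)
  have sub: "(\<lambda>A. inv \<pi> ` A) ` core_family n k (\<pi> ` T) (\<pi> ` L) \<subseteq> core_family n k T L"
    using core_family_image_subset[OF permutes_inv[OF assms], of "\<pi> ` T" "\<pi> ` L"] unfolding id .
  show "core_family n k (\<pi> ` T) (\<pi> ` L) \<subseteq> (\<lambda>A. \<pi> ` A) ` core_family n k T L"
  proof
    fix B assume "B \<in> core_family n k (\<pi> ` T) (\<pi> ` L)"
    then have "inv \<pi> ` B \<in> core_family n k T L" using sub by blast
    then have "\<pi> ` (inv \<pi> ` B) \<in> (\<lambda>A. \<pi> ` A) ` core_family n k T L" by (rule imageI)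
    then show "B \<in> (\<lambda>A. \<pi> ` A) ` core_family n k T L" unfolding id .
  qed
qed

lemma core_pair_image:
  assumes "\<pi> permutes {1..n}" "core_pair T L"
  shows "core_pair (\<pi> ` T) (\<pi> ` L)" "card (\<pi> ` L) = card L"
proof -
  have inj: "inj \<pi>" using assms(1) by (rule permutes_inj)
  show c: "card (\<pi> ` L) = card L" using inj by (simp add: card_image inj_on_subset[OF inj])
  have "\<pi> ` T \<subseteq> \<pi> ` {1..n}" "\<pi> ` L \<subseteq> \<pi> ` {1..n}" using assms(2) unfolding core_pair_def by blast+
  then have "\<pi> ` T \<subseteq> {1..n}" "\<pi> ` L \<subseteq> {1..n}" using assms(1) by (simp_all add: permutes_image)
  moreover have "card (\<pi> ` T) = card T" using inj by (simp add: card_image inj_on_subset[OF inj])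
  moreover have "\<pi> ` T \<inter> \<pi> ` L = {}"
    using assms(2) inj unfolding core_pair_def by (simp add: image_Int[symmetric])
  ultimately show "core_pair (\<pi> ` T) (\<pi> ` L)" using c assms(2) unfolding core_pair_def by simp
qed

definition extremal :: "nat set set \<Rightarrow> bool" where
  "extremal \<F> \<longleftrightarrow> (\<exists>T L. core_pair T L \<and> (card L = 2 \<or> card L = k - t + 1) \<and> \<F> = core_family n k T L)"

lemma admissible_finite: "admissible \<F> \<Longrightarrow> finite \<F>"
  unfolding admissible_def using finite_subset[OF _ finite_nsets_interval] by blast

lemma admissibleD: "admissible \<F> \<Longrightarrow> A \<in> \<F> \<Longrightarrow> A \<subseteq> {1..n} \<and> card A = k \<and> finite A"
  unfolding admissible_def nsets_def by blast

lemma extremal_if_shift_extremal: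
  assumes F: "admissible \<F>" and ij: "i \<in> {1..n}" "j \<in> {1..n}" "i \<noteq> j" and ext: "extremal (shift i j \<F>)"
  shows "extremal \<F>"
proof -
  obtain T L where TL: "core_pair T L" "card L = 2 \<or> card L = k - t + 1" "shift i j \<F> = core_family n k T L"
    using ext unfolding extremal_def by blast
  have "tightly_connected t (movable i j (shift i j \<F>))"
    using TL(2) movable_core_two_tightly_connected[OF TL(1) _ ij(2)]
      movable_core_large_tightly_connected[OF TL(1) _ ij(3,2)] unfolding TL(3) by blast
  moreover have "intersecting t \<F>" "\<And>A. A \<in> \<F> \<Longrightarrow> finite A"
    using F admissibleD unfolding admissible_def by auto
  ultimately have "\<F> = shift i j \<F> \<or> \<F> = (\<lambda>A. transpose i j ` A) ` shift i j \<F>"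
    using shift_preimage[of t \<F> i j] t_pos admissible_finite[OF F] ij(3) by blast
  then show ?thesis
  proof
    assume "\<F> = shift i j \<F>"
    then show ?thesis using ext by simp
  next
    assume eq: "\<F> = (\<lambda>A. transpose i j ` A) ` shift i j \<F>"
    have perm: "transpose i j permutes {1..n}" using ij by (intro permutes_swap_id) auto
    have "\<F> = core_family n k (transpose i j ` T) (transpose i j ` L)"
      using eq core_family_image[OF perm, of T L] unfolding TL(3) by simp
    then show ?thesis using core_pair_image[OF perm TL(1)] TL(2) unfolding extremal_def by metis
  qed
qed

end

section \<open>Traces on a window\<close>

context large_ground_set
begin

definition traces :: "nat set \<Rightarrow> nat set set \<Rightarrow> nat set set" where
  "traces W \<F> = (\<lambda>A. A \<inter> W) ` \<F>"

text \<open>Compressions act on \<open>Y\<close> only, so the points outside \<open>Y\<close> are not ordered relative to \<open>p\<close> and belong to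
every window.\<close>

definition window :: "nat set \<Rightarrow> nat \<Rightarrow> nat set" where
  "window Y p = {x \<in> {1..n}. x \<in> Y \<longrightarrow> x \<le> p}"

lemma traces_finite:
  assumes "admissible \<F>" "E \<in> traces W \<F>"
  shows "finite E" "card E \<le> k" "E \<subseteq> W"
proof -
  obtain A where A: "A \<in> \<F>" "E = A \<inter> W" using assms(2) unfolding traces_def by blast
  have fA: "finite A" "card A = k" using admissibleD[OF assms(1) A(1)] by auto
  then have "card E \<le> card A" unfolding A(2) by (intro card_mono) auto
  then show "finite E" "card E \<le> k" "E \<subseteq> W" using fA A by auto
qed

text \<open>The cylinder over the traces contains the family and inherits the intersection property, so
maximality forces equality.\<close>

lemma maximum_eq_cylinder:
  assumes F: "maximum \<F>" and "intersecting t (traces W \<F>)"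
  shows "cylinder n k W (traces W \<F>) = \<F>"
proof (rule maximum_superset[OF F])
  show "\<F> \<subseteq> cylinder n k W (traces W \<F>)"
    using F unfolding maximum_def admissible_def cylinder_def traces_def by blast
  show "cylinder n k W (traces W \<F>) \<subseteq> nsets {1..n} k" unfolding cylinder_def by blast
  show "intersecting t (cylinder n k W (traces W \<F>))" using assms(2) by (rule intersecting_cylinder)
qed

lemma traces_stable:
  assumes "stable Y \<F>"
  shows "stable (Y \<inter> W) (traces W \<F>)"
  unfolding stable_def
proof (intro ballI impI)
  fix u v E assume uv: "u \<in> Y \<inter> W" "v \<in> Y \<inter> W" "E \<in> traces W \<F>" "u < v" "v \<in> E" "u \<notin> E"
  then obtain A where A: "A \<in> \<F>" "E = A \<inter> W" unfolding traces_def by blast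
  then have "replace u v A \<in> \<F>" using uv by (intro stableD[OF assms]) auto
  moreover have "replace u v E = replace u v A \<inter> W" using A uv unfolding replace_def by blast
  ultimately show "replace u v E \<in> traces W \<F>" unfolding traces_def by blast
qed

text \<open>A point \<open>y\<close> of \<open>Y\<close> outside \<open>E \<union> E'\<close> could replace \<open>p\<close> in \<open>E\<close>, which would leave fewer than \<open>t\<close> common
points. So the two traces cover \<open>Y\<close>, and this determines the sum of their sizes.\<close>

lemma conflict_facts:
  assumes U: "intersecting t U" "stable Y U" and E: "E \<in> U" "E' \<in> U" "finite E" "finite E'"
    and lt: "card (E \<inter> E' - {p}) < t" and p: "p \<in> Y" "\<And>y. y \<in> Y \<Longrightarrow> y \<le> p"
  shows "p \<in> E" "p \<in> E'" "card (E \<inter> E') = t" "E - {p} \<notin> U" "E' - {p} \<notin> U" "Y \<subseteq> E \<union> E'"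
proof -
  have ge: "t \<le> card (E \<inter> E')" using intersectingD[OF U(1)] E by blast
  have "p \<in> E \<inter> E'"
  proof (rule ccontr)
    assume "p \<notin> E \<inter> E'"
    then have "E \<inter> E' - {p} = E \<inter> E'" by blast
    then show False using ge lt by simp
  qed
  then show pE: "p \<in> E" "p \<in> E'" by auto
  show "card (E \<inter> E') = t" using ge lt pE E(3) by (simp add: card_Diff_singleton_if)
  have "(E - {p}) \<inter> E' = E \<inter> E' - {p}" "E \<inter> (E' - {p}) = E \<inter> E' - {p}" by auto
  then show "E - {p} \<notin> U" "E' - {p} \<notin> U"
    using intersectingD[OF U(1), of "E - {p}" E'] intersectingD[OF U(1), of E "E' - {p}"] E lt by auto
  show "Y \<subseteq> E \<union> E'"
  proof
    fix y assume y: "y \<in> Y"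
    show "y \<in> E \<union> E'"
    proof (rule ccontr)
      assume n: "y \<notin> E \<union> E'"
      then have "y < p" using p(2)[OF y] pE by (metis UnI1 le_neq_implies_less)
      then have "replace y p E \<in> U" using n pE y p(1) E(1) by (intro stableD[OF U(2)]) auto
      then have "t \<le> card (replace y p E \<inter> E')" using E(2) by (rule intersectingD[OF U(1)])
      moreover have "replace y p E \<inter> E' = E \<inter> E' - {p}" using n unfolding replace_def by blast
      ultimately show False using lt by simp
    qed
  qed
qed

text \<open>Take the least \<open>p\<close> for which the traces on the window are still \<open>t\<close>-intersecting.\<close>

lemma exists_conflict:
  assumes F: "admissible \<F>" and Y: "Y \<subseteq> {1..n}" and no: "\<not> intersecting t (traces ({1..n} - Y) \<F>)"
  shows "\<exists>p\<in>Y. intersecting t (traces (window Y p) \<F>) \<and>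
    (\<exists>E\<in>traces (window Y p) \<F>. \<exists>E'\<in>traces (window Y p) \<F>. card (E \<inter> E' - {p}) < t)"
proof -
  let ?P = "\<lambda>p. intersecting t (traces (window Y p) \<F>)"
  define p where "p = (LEAST p. ?P p)"
  have "traces (window Y n) \<F> = \<F>"
  proof -
    have "A \<inter> window Y n = A" if "A \<in> \<F>" for A using admissibleD[OF F that] unfolding window_def by auto
    then show ?thesis unfolding traces_def by simp
  qed
  then have "?P n" using F unfolding admissible_def by simp
  then have Pp: "?P p" unfolding p_def by (rule LeastI)
  have "window Y 0 = {1..n} - Y" using Y unfolding window_def by auto
  then have "\<not> ?P 0" using no by simp
  then have p0: "p \<noteq> 0" using Pp by metis
  then have "\<not> ?P (p - 1)" unfolding p_def by (metis not_less_Least diff_less zero_less_one gr0I p_def)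
  then obtain A B where AB: "A \<in> \<F>" "B \<in> \<F>" "card ((A \<inter> window Y (p - 1)) \<inter> (B \<inter> window Y (p - 1))) < t"
    unfolding intersecting_def traces_def by (auto simp: not_le)
  have pY: "p \<in> Y"
  proof (rule ccontr)
    assume "p \<notin> Y"
    then have "window Y p = window Y (p - 1)" using p0 unfolding window_def by (auto simp: le_less)
    then show False using Pp \<open>\<not> ?P (p - 1)\<close> by simp
  qed
  have "window Y (p - 1) = window Y p - {p}" using pY p0 unfolding window_def by auto
  then have "(A \<inter> window Y (p - 1)) \<inter> (B \<inter> window Y (p - 1)) = (A \<inter> window Y p) \<inter> (B \<inter> window Y p) - {p}" by blast
  then have "card ((A \<inter> window Y p) \<inter> (B \<inter> window Y p) - {p}) < t" using AB(3) by simp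
  then show ?thesis using pY Pp AB(1,2) unfolding traces_def by blast
qed

text \<open>One of the two trades would yield a larger \<open>t\<close>-intersecting family, so it must be a trivial one. Both
families are mentioned because \<open>trade_gain\<close> does not tell which trade pays.\<close>

lemma trade_trivial:
  assumes F: "maximum \<F>" and W: "W \<subseteq> {1..n}" and U: "U = traces W \<F>" "intersecting t U"
    and X: "X \<subseteq> {E \<in> U. p \<in> E \<and> E - {p} \<notin> U \<and> card E = a}" "X \<noteq> {}"
    and Y: "Y \<subseteq> {E \<in> U. p \<in> E \<and> E - {p} \<notin> U \<and> card E = b}" "Y \<noteq> {}"
    and XY: "X \<inter> Y = {}" "a + b = card W + t"
    and confX: "\<And>E E'. E \<in> X \<Longrightarrow> E' \<in> U \<Longrightarrow> card (E \<inter> E' - {p}) < t \<Longrightarrow> E' \<in> Y"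
    and confY: "\<And>E E'. E \<in> Y \<Longrightarrow> E' \<in> U \<Longrightarrow> card (E \<inter> E' - {p}) < t \<Longrightarrow> E' \<in> X"
  shows "\<not> nontrivial t (cylinder n k W ((U - Y) \<union> (\<lambda>E. E - {p}) ` X)) \<or>
    \<not> nontrivial t (cylinder n k W ((U - X) \<union> (\<lambda>E. E - {p}) ` Y))"
proof (rule ccontr)
  let ?G = "cylinder n k W ((U - Y) \<union> (\<lambda>E. E - {p}) ` X)"
  let ?H = "cylinder n k W ((U - X) \<union> (\<lambda>E. E - {p}) ` Y)"
  assume "\<not> ?thesis"
  then have nt: "nontrivial t ?G" "nontrivial t ?H" by auto
  have adm: "admissible \<F>" using F unfolding maximum_def by blast
  have UW: "U \<subseteq> Pow W" "\<And>E. E \<in> U \<Longrightarrow> finite E \<and> card E \<le> k"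
    using traces_finite[OF adm] unfolding U(1) by blast+
  have XYU: "X \<subseteq> U" "Y \<subseteq> U" "Y \<inter> X = {}" using X(1) Y(1) XY(1) by auto
  have "intersecting t ?G"
    by (rule intersecting_cylinder, rule intersecting_trade[OF U(2) XYU(1) XY(1)], rule confX)
  moreover have "intersecting t ?H"
    by (rule intersecting_cylinder, rule intersecting_trade[OF U(2) XYU(2,3)], rule confY)
  ultimately have "admissible ?G" "admissible ?H"
    using nt unfolding admissible_def by (auto simp: cylinder_def)
  then have le: "card ?G \<le> card \<F>" "card ?H \<le> card \<F>" using F unfolding maximum_def by auto
  have eq: "cylinder n k W U = \<F>" using maximum_eq_cylinder[OF F] U by simp
  have a: "1 \<le> a" "a \<le> k"
  proof -
    obtain E where "E \<in> X" using X(2) by blast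
    then have "E \<in> U" "p \<in> E" "card E = a" using X(1) by auto
    then show "1 \<le> a" "a \<le> k" using UW(2)[of E] by (auto simp: Suc_le_eq card_gt_0_iff)
  qed
  have b: "1 \<le> b" "b \<le> k"
  proof -
    obtain E where "E \<in> Y" using Y(2) by blast
    then have "E \<in> U" "p \<in> E" "card E = b" using Y(1) by auto
    then show "1 \<le> b" "b \<le> k" using UW(2)[of E] by (auto simp: Suc_le_eq card_gt_0_iff)
  qed
  have "card (cylinder n k W U) < card ?G \<or> card (cylinder n k W U) < card ?H"
    using X Y by (intro trade_gain[OF W UW(1) _ X(2) _ Y(2) _ _ _ _ _ _ a b XY(2) n_ge]) blast+
  then show False using le unfolding eq by linarith
qed

end

section \<open>Compressed maximum families\<close>

text \<open>Each \<open>E\<close> misses \<open>p - a\<close> of the \<open>p - 1\<close> points below \<open>p\<close>, so on average a point below \<open>p\<close> is missed by the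
fraction \<open>(p - a) / (p - 1)\<close> of the sets.\<close>

lemma exists_rarely_covered:
  assumes X: "finite X" "\<And>E. E \<in> X \<Longrightarrow> E \<subseteq> {1..p} \<and> p \<in> E \<and> card E = a" and p: "2 \<le> p"
  shows "\<exists>m\<in>{1..<p}. card X * (p - a) \<le> (p - 1) * card {E \<in> X. m \<notin> E}"
proof (rule ccontr)
  assume "\<not> ?thesis"
  then have less: "(p - 1) * card {E \<in> X. m \<notin> E} < card X * (p - a)" if "m \<in> {1..<p}" for m
    using that by (auto simp: not_le)
  have row: "card {m \<in> {1..<p}. m \<notin> E} = p - a" if E: "E \<in> X" for E
  proof -
    have "{m \<in> {1..<p}. m \<notin> E} = {1..p} - E" using X(2)[OF E] by (auto simp: le_less)
    moreover have "finite E" using X(2)[OF E] finite_subset by blast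
    ultimately show ?thesis using X(2)[OF E] by (simp add: card_Diff_subset)
  qed
  have "(\<Sum>m\<in>{1..<p}. card {E \<in> X. m \<notin> E}) = (\<Sum>m\<in>{1..<p}. \<Sum>E\<in>X. if m \<notin> E then 1 else 0)"
    using X(1) by (simp add: sum.If_cases Int_def)
  also have "\<dots> = (\<Sum>E\<in>X. \<Sum>m\<in>{1..<p}. if m \<notin> E then 1 else 0)" by (rule sum.swap)
  also have "\<dots> = (\<Sum>E\<in>X. card {m \<in> {1..<p}. m \<notin> E})"
    by (simp add: sum.If_cases Int_def)
  also have "\<dots> = card X * (p - a)" using row by simp
  finally have total: "(\<Sum>m\<in>{1..<p}. card {E \<in> X. m \<notin> E}) = card X * (p - a)" .
  have "(\<Sum>m\<in>{1..<p}. (p - 1) * card {E \<in> X. m \<notin> E}) < (\<Sum>m\<in>{1..<p}. card X * (p - a))"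
    using less p by (intro sum_strict_mono) auto
  then show False using total by (simp add: sum_distrib_left[symmetric])
qed

context large_ground_set
begin

text \<open>The common points of these sets are just \<open>1, \<dots>, t - 1\<close>. Checking nontriviality after a trade
reduces to checking that none of these sets has been discarded.\<close>

lemma nontrivial_if_punctured_intervals:
  assumes "\<And>x. x \<in> {t..k + 1} \<Longrightarrow> {1..k + 1} - {x} \<in> \<G>"
  shows "nontrivial t \<G>"
  unfolding nontrivial_def
proof
  assume "\<exists>T. card T = t \<and> (\<forall>A\<in>\<G>. T \<subseteq> A)"
  then obtain T where T: "card T = t" "\<And>A. A \<in> \<G> \<Longrightarrow> T \<subseteq> A" by blast
  have "z \<in> {1..t - 1}" if z: "z \<in> T" for z
  proof -
    have "z \<in> {1..k + 1} - {x}" if "x \<in> {t..k + 1}" for x using T(2)[OF assms[OF that]] z by blast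
    then have "z \<in> {1..k + 1}" "z \<notin> {t..k + 1}" using t_less by fastforce+
    then show ?thesis by auto
  qed
  then have "card T \<le> card {1..t - 1}" by (intro card_mono) auto
  then show False using T(1) t_pos by simp
qed

lemma punctured_intervals_in_stable:
  assumes F: "admissible \<F>" "stable {1..n} \<F>" and x: "x \<in> {t..k + 1}"
  shows "{1..k + 1} - {x} \<in> \<F>"
proof -
  have kn: "k + 1 \<le> n" using n_ge t_less by linarith
  have "nontrivial t \<F>" using F(1) unfolding admissible_def by blast
  then obtain A where A: "A \<in> \<F>" "\<not> {1..t} \<subseteq> A" unfolding nontrivial_def by (metis card_atLeastAtMost diff_Suc_1)
  then obtain y where y: "y \<in> {1..t}" "y \<notin> A" by blast
  have "\<exists>B\<in>\<F>. t \<notin> B"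
  proof (cases "t \<in> A")
    case True
    then have "y < t" using y by (metis atLeastAtMost_iff le_neq_implies_less)
    moreover have "y \<in> {1..n}" "t \<in> {1..n}" using y t_less kn t_pos by auto
    ultimately have "replace y t A \<in> \<F>" using stableD[OF F(2)] A(1) True y by blast
    moreover have "t \<notin> replace y t A" using \<open>y < t\<close> unfolding replace_def by auto
    ultimately show ?thesis by blast
  qed (use A in blast)
  then obtain B where B: "B \<in> \<F>" "t \<notin> B" by blast
  have B': "B \<subseteq> {1..n}" "card B = k" "finite B" using admissibleD[OF F(1) B(1)] by auto
  let ?S = "{1..k + 1} - {t}"
  have "B \<inter> ({1..n} - {t}) = B" using B B' by blast
  moreover have "card ?S = k" using t_pos t_less by simp
  ultimately have "card (B \<inter> ({1..n} - {t})) = card ?S" using B' by simp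
  moreover have "?S \<subseteq> {1..n} - {t}" using kn by auto
  ultimately have "(B - ({1..n} - {t})) \<union> ?S \<in> \<F>"
    using B' by (intro stable_initial_segment[OF F(2) _ _ _ B(1)]) auto
  moreover have "B - ({1..n} - {t}) = {}" using B B' by blast
  ultimately have S: "?S \<in> \<F>" by (metis Un_empty_left)
  show ?thesis
  proof (cases "x = t")
    case True
    then show ?thesis using S by simp
  next
    case False
    then have "t < x" "x \<in> {1..n}" "t \<in> {1..n}" using x kn t_pos t_less by auto
    moreover have "x \<in> ?S" using x False by auto
    ultimately have "replace t x ?S \<in> \<F>" using stableD[OF F(2)] S by blast
    moreover have "replace t x ?S = {1..k + 1} - {x}"
      using \<open>t < x\<close> t_pos t_less unfolding replace_def by auto
    ultimately show ?thesis by simp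
  qed
qed

text \<open>With \<open>a = t + r\<close>, \<open>q = k - a\<close> and \<open>N = n - p\<close>, and after dividing by \<open>N choose q\<close>, averaging reduces the claim to
\<open>(t + 2 r - 1) (q + 1) < r (N + 1)\<close>. Adding \<open>r (t + 2 r - 1)\<close> to both sides turns it into
\<open>(t + 2 r - 1) (k - t + 1) < r n\<close>, which follows from the bound on \<open>n\<close> because
\<open>r (t + 3) - 2 (t + 2 r - 1) = (r - 2) (t - 1) \<ge> 0\<close>.\<close>

lemma equal_size_gain:
  assumes a: "t + 2 \<le> a" "a \<le> k" and p: "p + t = 2 * a" and X: "0 < x" and c: "c \<le> x"
    and cx: "x * (p - a) \<le> (p - 1) * c"
  shows "(x - c) * ((n - p) choose (k - a)) < c * ((n - p) choose Suc (k - a))"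
proof -
  define r q N where "r = a - t" and "q = k - a" and "N = n - p"
  have r: "2 \<le> r" "a = t + r" "p = t + 2 * r" "p - a = r" "p - 1 = t + 2 * r - 1"
    using a p unfolding r_def by auto
  have k: "k = t + r + q" using a r unfolding q_def by simp
  have pn: "p + q + 1 \<le> n" using n_ge r(3) k t_less by linarith
  \<comment> \<open>The shifted variables make the product \<open>(r - 2) (t - 1)\<close> nonnegative without subtraction.\<close>
  obtain r' t' where r': "r = r' + 2" "t = t' + 1" using r(1) t_pos by (metis add.commute le_Suc_ex)
  have key: "(p - 1) * Suc q < r * Suc N"
  proof -
    have P: "p - 1 = t' + 2 * r' + 4" using r r' by simp
    have "t + 3 = t' + 4" "k - t + 1 = r' + q + 3" using r' k by simp_all
    then have "(t' + 4) * (r' + q + 3) < 2 * n" using n_large by metis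
    then have "r * ((t' + 4) * (r' + q + 3)) < r * (2 * n)"
      by (rule mult_strict_left_mono) (use r in simp)
    moreover have "r * (t' + 4) = 2 * (p - 1) + r' * t'" unfolding P r'(1) by (simp add: algebra_simps)
    ultimately have "2 * ((p - 1) * (r' + q + 3)) + r' * t' * (r' + q + 3) < 2 * (r * n)"
      by (metis (no_types, opaque_lifting) add_mult_distrib mult.assoc mult.left_commute)
    then have 1: "(p - 1) * (r' + q + 3) < r * n" by linarith
    have n: "n = Suc N + (p - 1)" using pn r unfolding N_def by simp
    have "r' + q + 3 = Suc q + r" using r'(1) by simp
    then have "(p - 1) * (r' + q + 3) = (p - 1) * Suc q + r * (p - 1)"
      by (metis distrib_left mult.commute)
    moreover have "r * n = r * Suc N + r * (p - 1)" using n by (metis distrib_left)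
    ultimately show ?thesis using 1 by linarith
  qed
  have pos: "0 < (N choose q)" using pn unfolding N_def by simp
  have p1: "0 < p - 1" using r by simp
  have "(p - 1) * (x * Suc q) = x * ((p - 1) * Suc q)" by (rule mult.left_commute)
  also have "\<dots> < x * (r * Suc N)" using key X by simp
  also have "\<dots> = (x * r) * Suc N" by (simp only: mult.assoc)
  also have "\<dots> \<le> ((p - 1) * c) * Suc N" using cx r(4) by (metis mult_le_mono1)
  also have "\<dots> = (p - 1) * (c * Suc N)" by (simp only: mult.assoc)
  finally have lt: "x * Suc q < c * Suc N" using p1 by simp
  have qN: "q \<le> N" using pn unfolding N_def by simp
  have "Suc q * (x * (N choose q)) = (x * Suc q) * (N choose q)" by (simp only: mult_ac)
  also have "\<dots> < (c * Suc N) * (N choose q)" using lt pos by (rule mult_strict_right_mono)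
  also have "\<dots> = c * ((N - q) * (N choose q)) + c * (Suc q * (N choose q))"
  proof -
    have "Suc N = (N - q) + Suc q" using qN by simp
    then show ?thesis by (metis add_mult_distrib distrib_left mult.assoc)
  qed
  also have "\<dots> = c * (Suc q * (N choose Suc q)) + c * (Suc q * (N choose q))"
    unfolding binomial_Suc_weight ..
  also have "\<dots> = Suc q * (c * (N choose Suc q) + c * (N choose q))"
    by (simp only: distrib_left mult.left_commute)
  finally have "x * (N choose q) < c * (N choose Suc q) + c * (N choose q)" by (simp only: mult_less_cancel1)
  moreover have "x * (N choose q) = (x - c) * (N choose q) + c * (N choose q)"
    using c by (simp add: add_mult_distrib[symmetric])
  ultimately show ?thesis unfolding q_def[symmetric] N_def[symmetric] by linarith
qed

end

context large_ground_set
begin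

text \<open>The generating set argument for compressed families. Nontriviality survives a trade that discards
traces of size \<open>b < p\<close> unless \<open>p \<le> k + 1\<close> and \<open>b = p - 1\<close>, since the traces of the punctured intervals have
size \<open>p - 1\<close> or \<open>p\<close> if they contain \<open>p\<close> at all. As the two sizes in a conflict add up to \<open>p + t\<close>, the
exceptional case leaves the size \<open>t + 1\<close> for the other trace. Compressing it shows that \<open>{1..t}\<close>
together with any point of \<open>{t + 1..p}\<close> is a trace, and comparing all members with these traces
and with \<open>{1..p} - {t}\<close> gives the structure.\<close>

lemma stable_maximum_in_core_family:
  assumes F: "maximum \<F>" and st: "stable {1..n} \<F>"
  shows "\<exists>T L. core_pair T L \<and> \<F> \<subseteq> core_family n k T L"
proof -
  have adm: "admissible \<F>" using F unfolding maximum_def by blast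
  have kn: "k + 1 \<le> n" using n_ge t_less by linarith
  note R = punctured_intervals_in_stable[OF adm st]
  have "{} \<in> traces ({1..n} - {1..n}) \<F>" using R[of t] t_less unfolding traces_def by auto
  then have "\<not> intersecting t (traces ({1..n} - {1..n}) \<F>)"
    using t_pos unfolding intersecting_def by fastforce
  from exists_conflict[OF adm _ this] obtain p E E' where p: "p \<in> {1..n}"
    and int: "intersecting t (traces (window {1..n} p) \<F>)"
    and E: "E \<in> traces (window {1..n} p) \<F>" "E' \<in> traces (window {1..n} p) \<F>" "card (E \<inter> E' - {p}) < t"
    by blast
  have win: "window {1..n} p = {1..p}" using p unfolding window_def by auto
  define U where "U = traces {1..p} \<F>"
  have U: "intersecting t U" using int unfolding U_def win .
  have EU: "E \<in> U" "E' \<in> U" using E unfolding U_def win by auto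
  have Ufin: "finite C" "card C \<le> k" "C \<subseteq> {1..p}" if "C \<in> U" for C
    using traces_finite[OF adm] that unfolding U_def by blast+
  have finU: "finite U" using admissible_finite[OF adm] unfolding U_def traces_def by simp
  have stU: "stable {1..p} U"
  proof -
    have "{1..n} \<inter> {1..p} = {1..p}" using p by auto
    then show ?thesis using traces_stable[OF st, of "{1..p}"] unfolding U_def by metis
  qed
  have cyl: "cylinder n k {1..p} U = \<F>" using maximum_eq_cylinder[OF F] U unfolding U_def by blast
  have Wn: "{1..p} \<subseteq> {1..n}" using p by auto
  have conf: "p \<in> C \<and> p \<in> C' \<and> C - {p} \<notin> U \<and> C' - {p} \<notin> U \<and> {1..p} \<subseteq> C \<union> C' \<and> card C + card C' = p + t"
    if C: "C \<in> U" "C' \<in> U" "card (C \<inter> C' - {p}) < t" for C C'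
  proof -
    note f = conflict_facts[OF U stU C(1,2) Ufin(1)[OF C(1)] Ufin(1)[OF C(2)] C(3)]
    have p1: "p \<in> {1..p}" "\<And>y. y \<in> {1..p} \<Longrightarrow> y \<le> p" using p by auto
    have "C \<union> C' = {1..p}" using f(6)[OF p1] Ufin(3) C by blast
    then have "card C + card C' = p + t"
      using card_Un_Int[OF Ufin(1)[OF C(1)] Ufin(1)[OF C(2)]] f(3)[OF p1] by simp
    then show ?thesis using f[OF p1] by blast
  qed
  have big: "t + 1 \<le> card C" if C: "C \<in> U" for C
  proof (rule ccontr)
    assume "\<not> ?thesis"
    moreover have ge: "t \<le> card (C \<inter> D)" if "D \<in> U" for D using intersectingD[OF U C that] .
    ultimately have cC: "card C = t" using ge[OF C] by simp
    have "C \<subseteq> A" if A: "A \<in> \<F>" for A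
    proof -
      have "A \<inter> {1..p} \<in> U" using A unfolding U_def traces_def by blast
      from ge[OF this] have "card C \<le> card (C \<inter> (A \<inter> {1..p}))" using cC by simp
      then have "C \<inter> (A \<inter> {1..p}) = C" using Ufin(1)[OF C] by (intro card_seteq) auto
      then show ?thesis by blast
    qed
    then show False using adm cC unfolding admissible_def nontrivial_def by blast
  qed
  \<comment> \<open>Outside the exceptional case, no punctured interval has a discarded trace.\<close>
  have keep: "nontrivial t (cylinder n k {1..p} ((U - D) \<union> D'))"
    if D: "\<And>C. C \<in> D \<Longrightarrow> p \<in> C \<and> card C = b" and b: "b < p" "\<not> (p \<le> k + 1 \<and> b = p - 1)" for D D' b
  proof (rule nontrivial_if_punctured_intervals)
    fix x assume x: "x \<in> {t..k + 1}"
    let ?R = "{1..k + 1} - {x}"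
    have "?R \<in> cylinder n k {1..p} U" using R[OF x] unfolding cyl .
    then have m: "?R \<in> nsets {1..n} k" "?R \<inter> {1..p} \<in> U" unfolding cylinder_def by auto
    have "?R \<inter> {1..p} \<notin> D"
    proof
      assume "?R \<inter> {1..p} \<in> D"
      then have pR: "p \<in> ?R" and c: "card (?R \<inter> {1..p}) = b" using D by blast+
      have pk: "p \<le> k + 1" using pR by simp
      then have "?R \<inter> {1..p} = {1..p} - {x}" by auto
      then have "b = p \<or> b = p - 1" using c x t_pos by (auto simp: card_Diff_singleton_if split: if_splits)
      then show False using b pk by auto
    qed
    then show "?R \<in> cylinder n k {1..p} ((U - D) \<union> D')" using m unfolding cylinder_def by blast
  qed
  \<comment> \<open>A trace of size \<open>t + 1\<close> that contains \<open>p\<close> determines the structure.\<close>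
  have core: ?thesis if C: "C \<in> U" "card C = t + 1" "p \<in> C" and pk: "t + 2 \<le> p" "p \<le> k + 1" for C
  proof (intro exI conjI)
    show "core_pair {1..t} {t + 1..p}" using pk p t_pos t_less unfolding core_pair_def by auto
    have iv: "{1..p - 1} = {1..p} - {p}" by auto
    have "C - {1..p - 1} = {p}" using Ufin(3)[OF C(1)] C(3) unfolding iv by blast
    moreover have "C \<inter> {1..p - 1} = C - {p}" using Ufin(3)[OF C(1)] unfolding iv by blast
    then have "card (C \<inter> {1..p - 1}) = card {1..t}" using C Ufin(1)[OF C(1)] by simp
    then have "(C - {1..p - 1}) \<union> {1..t} \<in> U"
      using pk Ufin(1)[OF C(1)] by (intro stable_initial_segment[OF stU _ _ _ C(1)]) auto
    ultimately have tp: "insert p {1..t} \<in> U" by (metis insert_is_Un)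
    have ts: "insert s {1..t} \<in> U" if s: "s \<in> {t + 1..p}" for s
    proof (cases "s = p")
      case False
      then have "replace s p (insert p {1..t}) \<in> U" using s pk by (intro stableD[OF stU _ _ _ tp]) auto
      moreover have "insert p {1..t} - {p} = {1..t}" using pk by auto
      ultimately show ?thesis unfolding replace_def by simp
    qed (use tp in simp)
    have "{1..k + 1} - {t} \<in> \<F>" using R[of t] t_less by simp
    then have "({1..k + 1} - {t}) \<inter> {1..p} \<in> U" unfolding U_def traces_def by blast
    moreover have "({1..k + 1} - {t}) \<inter> {1..p} = {1..p} - {t}" using pk by auto
    ultimately have pt: "{1..p} - {t} \<in> U" by simp
    show "\<F> \<subseteq> core_family n k {1..t} {t + 1..p}"
    proof
      fix A assume A: "A \<in> \<F>"
      have AU: "A \<inter> {1..p} \<in> U" using A unfolding U_def traces_def by blast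
      have An: "A \<in> nsets {1..n} k" using A adm unfolding admissible_def by blast
      show "A \<in> core_family n k {1..t} {t + 1..p}"
      proof (cases "{1..t} \<subseteq> A")
        case True
        have "A \<inter> {t + 1..p} \<noteq> {}"
        proof
          assume e: "A \<inter> {t + 1..p} = {}"
          have "(A \<inter> {1..p}) \<inter> ({1..p} - {t}) \<subseteq> {1..t - 1}"
          proof
            fix z assume z: "z \<in> (A \<inter> {1..p}) \<inter> ({1..p} - {t})"
            then have "z \<notin> {t + 1..p}" using e by blast
            then show "z \<in> {1..t - 1}" using z by auto
          qed
          then have "card ((A \<inter> {1..p}) \<inter> ({1..p} - {t})) \<le> card {1..t - 1}" by (intro card_mono) auto
          then show False using intersectingD[OF U AU pt] t_pos by simp
        qed
        then show ?thesis using True An unfolding core_family_def by blast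
      next
        case False
        then obtain x where x: "x \<in> {1..t}" "x \<notin> A" by blast
        have sx: "s \<in> A \<and> {1..t} - {x} \<subseteq> A" if s: "s \<in> {t + 1..p}" for s
        proof -
          have sub: "(A \<inter> {1..p}) \<inter> insert s {1..t} \<subseteq> insert s ({1..t} - {x})" using x by blast
          have "card (insert s ({1..t} - {x})) = t" using x s by simp
          then have "(A \<inter> {1..p}) \<inter> insert s {1..t} = insert s ({1..t} - {x})"
            using intersectingD[OF U AU ts[OF s]] sub by (intro card_seteq) auto
          then show ?thesis by blast
        qed
        have "p \<in> {t + 1..p}" using pk by simp
        then have "{1..t} - A = {x}" using sx x by blast
        then show ?thesis using sx An unfolding core_family_def by auto
      qed
    qed
  qed
  \<comment> \<open>The traces that really need the point \<open>p\<close>; every conflict takes place between two of them.\<close>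
  define V where "V = {C \<in> U. p \<in> C \<and> C - {p} \<notin> U}"
  have cE: "E \<in> V" "E' \<in> V" "card E + card E' = p + t"
    using conf[OF EU E(3)] EU unfolding V_def by auto
  have EE: "t + 1 \<le> card E" "t + 1 \<le> card E'" using big EU by auto
  have pin: "p \<in> E" "p \<in> E'" using cE unfolding V_def by auto
  show ?thesis
  proof (cases "card E = card E'")
    case False
    let ?X = "{C \<in> V. card C = card E}" let ?Y = "{C \<in> V. card C = card E'}"
    have "\<not> nontrivial t (cylinder n k {1..p} ((U - ?Y) \<union> (\<lambda>E. E - {p}) ` ?X)) \<or>
      \<not> nontrivial t (cylinder n k {1..p} ((U - ?X) \<union> (\<lambda>E. E - {p}) ` ?Y))"
    proof (rule trade_trivial[OF F Wn U_def U, of ?X p "card E" ?Y "card E'"])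
      show "C' \<in> ?Y" if "C \<in> ?X" "C' \<in> U" "card (C \<inter> C' - {p}) < t" for C C'
        using conf[of C C'] that cE(3) unfolding V_def by auto
      show "C' \<in> ?X" if "C \<in> ?Y" "C' \<in> U" "card (C \<inter> C' - {p}) < t" for C C'
        using conf[of C C'] that cE(3) unfolding V_def by auto
    qed (use cE False in \<open>auto simp: V_def\<close>)
    moreover have "nontrivial t (cylinder n k {1..p} ((U - ?Y) \<union> (\<lambda>E. E - {p}) ` ?X))"
      if "\<not> (p \<le> k + 1 \<and> card E' = p - 1)"
      using that EE cE(3) by (intro keep[of _ "card E'"]) (auto simp: V_def)
    moreover have "nontrivial t (cylinder n k {1..p} ((U - ?X) \<union> (\<lambda>E. E - {p}) ` ?Y))"
      if "\<not> (p \<le> k + 1 \<and> card E = p - 1)"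
      using that EE cE(3) by (intro keep[of _ "card E"]) (auto simp: V_def)
    ultimately have "p \<le> k + 1 \<and> card E' = p - 1 \<or> p \<le> k + 1 \<and> card E = p - 1" by blast
    then show ?thesis
    proof
      assume h: "p \<le> k + 1 \<and> card E' = p - 1"
      then have "card E = t + 1" using cE(3) p by auto
      then show ?thesis using core[OF EU(1) _ pin(1)] h EE(2) by simp
    next
      assume h: "p \<le> k + 1 \<and> card E = p - 1"
      then have "card E' = t + 1" using cE(3) p by auto
      then show ?thesis using core[OF EU(2) _ pin(2)] h EE(1) by simp
    qed
  next
    case eq: True
    define a where "a = card E"
    have pa: "p + t = 2 * a" using cE(3) eq unfolding a_def by simp
    show ?thesis
    proof (cases "a = t + 1")
      case True
      then show ?thesis using core[OF EU(1) _ pin(1)] pa t_less unfolding a_def by simp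
    next
      case False
      then have a: "t + 2 \<le> a" "a \<le> k" using EE(1) Ufin(2)[OF EU(1)] unfolding a_def by auto
      define X where "X = {C \<in> V. card C = a}"
      have X: "X \<subseteq> U" "E \<in> X" "finite X" using cE finU unfolding X_def a_def V_def by auto
      have "\<And>C. C \<in> X \<Longrightarrow> C \<subseteq> {1..p} \<and> p \<in> C \<and> card C = a"
        using Ufin(3) unfolding X_def V_def by blast
      moreover have "2 \<le> p" using pa a t_pos by linarith
      ultimately obtain m where m: "m \<in> {1..<p}" "card X * (p - a) \<le> (p - 1) * card {C \<in> X. m \<notin> C}"
        using exists_rarely_covered[OF X(3), of p a] by blast
      define M where "M = {C \<in> X. m \<notin> C}"
      have M: "M \<subseteq> X" unfolding M_def by blast
      let ?G = "cylinder n k {1..p} ((U - (X - M)) \<union> (\<lambda>C. C - {p}) ` M)"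
      have "C' \<in> X - M" if "C \<in> M" "C' \<in> U" "card (C \<inter> C' - {p}) < t" for C C'
      proof -
        have "C \<in> U" "card C = a" "m \<notin> C" using that(1) unfolding M_def X_def V_def by auto
        then have "C' \<in> V" "card C' = a" "{1..p} \<subseteq> C \<union> C'"
          using conf[of C C'] that(2,3) pa unfolding V_def by auto
        moreover have "m \<in> {1..p}" using m(1) by simp
        ultimately show ?thesis using \<open>m \<notin> C\<close> unfolding X_def M_def by blast
      qed
      then have "intersecting t ?G"
        using M X by (intro intersecting_cylinder intersecting_trade[OF U]) auto
      moreover have "nontrivial t ?G"
        using a pa by (intro keep[of _ a]) (auto simp: X_def V_def)
      ultimately have "admissible ?G" unfolding admissible_def by (auto simp: cylinder_def)
      then have le: "card ?G \<le> card \<F>" using F unfolding maximum_def by blast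
      have "card ?G + card (X - M) * ((n - card {1..p}) choose (k - a))
        = card (cylinder n k {1..p} U) + card M * ((n - card {1..p}) choose Suc (k - a))"
        using M X a Ufin(3) by (intro card_trade[OF Wn]) (auto simp: X_def V_def)
      moreover have "card (X - M) = card X - card M" using M X(3) by (simp add: card_Diff_subset finite_subset)
      moreover have "(card X - card M) * ((n - p) choose (k - a)) < card M * ((n - p) choose Suc (k - a))"
      proof (rule equal_size_gain[OF a pa])
        show "0 < card X" using X by (auto simp: card_gt_0_iff)
        show "card M \<le> card X" using M X(3) by (rule card_mono[rotated])
        show "card X * (p - a) \<le> (p - 1) * card M" using m(2) unfolding M_def .
      qed
      ultimately show ?thesis using le unfolding cyl by simp
    qed
  qed
qed

end

section \<open>Families that a compression makes trivial\<close>

lemma exists_initial_segment: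
  fixes Y :: "nat set"
  assumes "finite Y" "m \<le> card Y"
  shows "\<exists>S\<subseteq>Y. card S = m \<and> (\<forall>s\<in>S. \<forall>y\<in>Y - S. s < y)"
  using assms(2)
proof (induction m)
  case 0
  show ?case by (rule exI[of _ "{}"]) simp
next
  case (Suc m)
  then obtain S where S: "S \<subseteq> Y" "card S = m" "\<And>s y. s \<in> S \<Longrightarrow> y \<in> Y - S \<Longrightarrow> s < y" by auto
  have fin: "finite S" "finite (Y - S)" using finite_subset[OF S(1) assms(1)] assms(1) by simp_all
  have "Y - S \<noteq> {}"
  proof
    assume "Y - S = {}"
    then have "Y = S" using S(1) by blast
    then show False using S(2) Suc.prems by simp
  qed
  define u where "u = Min (Y - S)"
  have u: "u \<in> Y" "u \<notin> S" using Min_in[OF fin(2) \<open>Y - S \<noteq> {}\<close>] unfolding u_def by auto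
  have "u < y" if y: "y \<in> Y - insert u S" for y
  proof -
    have "u \<le> y" using y fin(2) unfolding u_def by (intro Min_le) auto
    then show ?thesis using y by (metis DiffD2 insertI1 le_neq_implies_less)
  qed
  then have "\<forall>s\<in>insert u S. \<forall>y\<in>Y - insert u S. s < y" using S(3) by blast
  moreover have "card (insert u S) = Suc m" using u S fin by simp
  moreover have "insert u S \<subseteq> Y" using u S by blast
  ultimately show ?case by blast
qed

context large_ground_set
begin

text \<open>A common \<open>t\<close>-set of the compressed family contains \<open>i\<close> but not \<open>j\<close>, since otherwise it would lie in all
members of \<open>\<F>\<close> already. Before the compression every member contains the rest of it, and \<open>i\<close> or \<open>j\<close>.\<close>

lemma shift_trivial_structure:
  assumes F: "admissible \<F>" and ij: "i \<noteq> j" and tr: "\<not> nontrivial t (shift i j \<F>)"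
  shows "\<exists>T. i \<notin> T \<and> j \<notin> T \<and> card T = t - 1 \<and> T \<subseteq> {1..n} \<and> (\<forall>A\<in>\<F>. T \<subseteq> A \<and> (i \<in> A \<or> j \<in> A)) \<and>
    (\<exists>A\<in>\<F>. i \<in> A \<and> j \<notin> A) \<and> (\<exists>A\<in>\<F>. j \<in> A \<and> i \<notin> A)"
proof -
  have nt: "nontrivial t \<F>" using F unfolding admissible_def by blast
  then have ne: "\<F> \<noteq> {}" unfolding nontrivial_def by (metis card_atLeastAtMost diff_Suc_1 empty_iff)
  obtain T where T: "card T = t" "\<And>A. A \<in> \<F> \<Longrightarrow> T \<subseteq> shift_set \<F> i j A"
    using tr unfolding nontrivial_def shift_def by blast
  have finT: "finite T" using T(1) t_pos by (metis card.infinite not_one_le_zero)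
  have nsub: "\<exists>A\<in>\<F>. \<not> S \<subseteq> A" if "card S = t" for S using nt that unfolding nontrivial_def by blast
  have iT: "i \<in> T"
  proof (rule ccontr)
    assume "i \<notin> T"
    then have "T \<subseteq> A" if "A \<in> \<F>" for A
      using T(2)[OF that] unfolding shift_set_def replace_def by (auto split: if_splits)
    then show False using nsub[OF T(1)] by blast
  qed
  have jT: "j \<notin> T"
  proof
    assume "j \<in> T"
    then have "T \<subseteq> A" if "A \<in> \<F>" for A
      using T(2)[OF that] ij unfolding shift_set_def replace_def by (auto split: if_splits)
    then show False using nsub[OF T(1)] by blast
  qed
  have all: "T - {i} \<subseteq> A \<and> (i \<in> A \<or> j \<in> A)" if A: "A \<in> \<F>" for A
    using T(2)[OF A] iT jT unfolding shift_set_def replace_def by (auto split: if_splits)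
  have c: "card (T - {i}) = t - 1" using iT T(1) by simp
  moreover have "T - {i} \<subseteq> {1..n}" using ne all admissibleD[OF F] by blast
  moreover have "\<exists>A\<in>\<F>. j \<in> A \<and> i \<notin> A" using nsub[OF T(1)] all by blast
  moreover have "\<exists>A\<in>\<F>. i \<in> A \<and> j \<notin> A"
  proof -
    have "card (insert j (T - {i})) = t" using c finT jT t_pos by simp
    from nsub[OF this] show ?thesis using all by blast
  qed
  ultimately show ?thesis using all jT by blast
qed

text \<open>All \<open>k\<close>-sets that contain \<open>Z = T \<union> {i, j}\<close> belong to \<open>\<F>\<close> by maximality, and together with one member
avoiding \<open>i\<close> and one avoiding \<open>j\<close> they guarantee nontriviality. Hence compressions outside \<open>Z\<close> are
harmless, and \<open>\<F>\<close> is stable under them. In a conflict one trace contains \<open>i\<close> and not \<open>j\<close>, and the other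
one \<open>j\<close> and not \<open>i\<close>. So traces that conflict are distinguished by their sides even if their sizes
agree, and a trade between the two sides always applies.\<close>

lemma hinged_maximum_in_core_family:
  assumes F: "maximum \<F>" and ij: "i \<noteq> j" "i \<in> {1..n}" "j \<in> {1..n}"
    and T: "i \<notin> T" "j \<notin> T" "card T = t - 1" "T \<subseteq> {1..n}"
    and all: "\<And>A. A \<in> \<F> \<Longrightarrow> T \<subseteq> A \<and> (i \<in> A \<or> j \<in> A)"
    and sides: "\<exists>A\<in>\<F>. i \<in> A \<and> j \<notin> A" "\<exists>A\<in>\<F>. j \<in> A \<and> i \<notin> A"
    and fixed: "\<And>u v. u \<in> {1..n} \<Longrightarrow> v \<in> {1..n} \<Longrightarrow> u < v \<Longrightarrow> nontrivial t (shift u v \<F>) \<Longrightarrow> shift u v \<F> = \<F>"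
  shows "\<exists>T L. core_pair T L \<and> \<F> \<subseteq> core_family n k T L"
proof -
  have adm: "admissible \<F>" using F unfolding maximum_def by blast
  have finT: "finite T" using T(4) by (rule finite_subset) simp
  define Z where "Z = insert i (insert j T)"
  define Y where "Y = {1..n} - Z"
  have Z: "finite Z" "card Z = t + 1" "Z \<subseteq> {1..n}" using T ij finT t_pos unfolding Z_def by auto
  have Yn: "Y \<subseteq> {1..n}" and YZ: "{1..n} - Y = Z" "Y \<inter> Z = {}" using Z unfolding Y_def by auto
  have one: "card (insert c T) = t" if "c = i \<or> c = j" for c using that T finT t_pos by auto
  have full: "A \<in> \<F>" if A: "A \<in> nsets {1..n} k" "Z \<subseteq> A" for A
  proof -
    let ?G = "\<F> \<union> {A \<in> nsets {1..n} k. Z \<subseteq> A}"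
    have "t \<le> card (A \<inter> B)" if AB: "A \<in> ?G" "B \<in> ?G" "Z \<subseteq> A \<or> Z \<subseteq> B" for A B
    proof -
      have "finite A" using AB(1) admissibleD[OF adm] by (auto simp: nsets_def)
      have TA: "T \<subseteq> C \<and> (i \<in> C \<or> j \<in> C)" if "C \<in> ?G" for C using that all unfolding Z_def by blast
      have "insert i T \<subseteq> A \<inter> B \<or> insert j T \<subseteq> A \<inter> B"
        using TA[OF AB(1)] TA[OF AB(2)] AB(3) unfolding Z_def by blast
      then show ?thesis using one \<open>finite A\<close> by (metis card_mono finite_Int)
    qed
    then have "intersecting t ?G"
      using adm unfolding admissible_def intersecting_def by blast
    then have "?G = \<F>" using adm unfolding admissible_def by (intro maximum_superset[OF F]) auto
    then show ?thesis using A by blast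
  qed
  have nontriv: "nontrivial t \<G>"
    if G: "\<And>A. A \<in> nsets {1..n} k \<Longrightarrow> Z \<subseteq> A \<Longrightarrow> A \<in> \<G>" "\<exists>A\<in>\<G>. j \<notin> A" "\<exists>A\<in>\<G>. i \<notin> A" for \<G>
    unfolding nontrivial_def
  proof
    assume "\<exists>S. card S = t \<and> (\<forall>A\<in>\<G>. S \<subseteq> A)"
    then obtain S where S: "card S = t" "\<And>A. A \<in> \<G> \<Longrightarrow> S \<subseteq> A" by blast
    have "z \<in> Z" if z: "z \<in> S" for z
    proof (rule ccontr)
      assume "z \<notin> Z"
      moreover have "k < n" "card Z \<le> k" using n_ge t_less Z by auto
      ultimately obtain A where "A \<subseteq> {1..n}" "card A = k" "Z \<subseteq> A" "z \<notin> A"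
        using exists_uniform_avoiding[of Z n z k] Z by blast
      then show False using G(1)[of A] S(2) z unfolding nsets_eq by blast
    qed
    moreover have "i \<notin> S" "j \<notin> S" using S(2) G by blast+
    ultimately have "S \<subseteq> T" unfolding Z_def by blast
    then have "card S \<le> t - 1" using T(3) finT card_mono by metis
    then show False using S(1) t_pos by simp
  qed
  have st: "stable Y \<F>"
  proof (rule stable_if_shift_eq)
    fix u v assume uv: "u \<in> Y" "v \<in> Y" "u < v"
    have m: "shift_set \<F> u v A \<in> shift u v \<F>" if "A \<in> \<F>" for A using that unfolding shift_def by blast
    have "nontrivial t (shift u v \<F>)"
    proof (rule nontriv)
      fix A assume A: "A \<in> nsets {1..n} k" "Z \<subseteq> A"
      have "replace u v A \<in> \<F>" if "v \<in> A" "u \<notin> A"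
      proof (rule full)
        have "finite A" using A unfolding nsets_def by blast
        then show "replace u v A \<in> nsets {1..n} k"
          using that uv A(1) Yn by (simp add: nsets_def card_replace) (auto simp: replace_def)
        show "Z \<subseteq> replace u v A" using A(2) uv YZ unfolding replace_def by blast
      qed
      then have "shift_set \<F> u v A = A" unfolding shift_set_def by auto
      then show "A \<in> shift u v \<F>" using m[OF full[OF A]] by simp
    next
      obtain A where A: "A \<in> \<F>" "i \<in> A" "j \<notin> A" using sides(1) by blast
      have "j \<notin> shift_set \<F> u v A" using A uv unfolding shift_set_def replace_def Y_def Z_def by auto
      then show "\<exists>A\<in>shift u v \<F>. j \<notin> A" using m[OF A(1)] by blast
    next
      obtain A where A: "A \<in> \<F>" "j \<in> A" "i \<notin> A" using sides(2) by blast
      have "i \<notin> shift_set \<F> u v A" using A uv unfolding shift_set_def replace_def Y_def Z_def by auto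
      then show "\<exists>A\<in>shift u v \<F>. i \<notin> A" using m[OF A(1)] by blast
    qed
    then show "shift u v \<F> = \<F>" using fixed uv Yn by blast
  qed
  have "\<not> intersecting t (traces ({1..n} - Y) \<F>)"
  proof
    assume int: "intersecting t (traces ({1..n} - Y) \<F>)"
    obtain A B where AB: "A \<in> \<F>" "j \<notin> A" "B \<in> \<F>" "i \<notin> B" using sides by blast
    have "t \<le> card ((A \<inter> Z) \<inter> (B \<inter> Z))"
      using int AB unfolding YZ traces_def by (intro intersectingD[of t]) auto
    also have "\<dots> \<le> card T" using AB finT unfolding Z_def by (intro card_mono) auto
    finally show False using T(3) t_pos by simp
  qed
  from exists_conflict[OF adm Yn this] obtain p E0 E0' where p: "p \<in> Y"
    and int: "intersecting t (traces (window Y p) \<F>)"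
    and E0: "E0 \<in> traces (window Y p) \<F>" "E0' \<in> traces (window Y p) \<F>" "card (E0 \<inter> E0' - {p}) < t"
    by blast
  define W where "W = window Y p"
  define Yp where "Yp = {y \<in> Y. y \<le> p}"
  have W: "W = Z \<union> Yp" unfolding W_def Yp_def window_def using Yn Z YZ by blast
  have finYp: "finite Yp" unfolding Yp_def using Yn by (auto intro: finite_subset)
  have ZYp: "Z \<inter> Yp = {}" "Y \<inter> W = Yp" unfolding W using YZ unfolding Yp_def by auto
  have cW: "card W = t + 1 + card Yp" unfolding W using Z finYp ZYp by (simp add: card_Un_disjoint)
  have Wn: "W \<subseteq> {1..n}" unfolding W_def window_def by blast
  define U where "U = traces W \<F>"
  have U: "intersecting t U" using int unfolding U_def W_def .
  have stU: "stable Yp U" using traces_stable[OF st, of W] unfolding ZYp U_def .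
  have Ufin: "finite C" "card C \<le> k" "C \<subseteq> W" if "C \<in> U" for C
    using traces_finite[OF adm] that unfolding U_def by blast+
  have cyl: "cylinder n k W U = \<F>" using maximum_eq_cylinder[OF F] U unfolding U_def by blast
  have UT: "T \<subseteq> C \<and> (i \<in> C \<or> j \<in> C)" if C: "C \<in> U" for C
    using C all unfolding U_def traces_def W Z_def by blast
  have pp: "p \<in> Yp" "\<And>y. y \<in> Yp \<Longrightarrow> y \<le> p" using p unfolding Yp_def by auto
  have pZ: "p \<notin> Z" using pp ZYp by blast
  have conf: "p \<in> C \<and> p \<in> C' \<and> C - {p} \<notin> U \<and> C' - {p} \<notin> U \<and> card C + card C' = card W + t \<and>
      (i \<in> C \<and> j \<notin> C \<and> j \<in> C' \<and> i \<notin> C' \<or> j \<in> C \<and> i \<notin> C \<and> i \<in> C' \<and> j \<notin> C')"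
    if C: "C \<in> U" "C' \<in> U" "card (C \<inter> C' - {p}) < t" for C C'
  proof -
    note f = conflict_facts[OF U stU C(1,2) Ufin(1)[OF C(1)] Ufin(1)[OF C(2)] C(3) pp]
    have "insert p T \<subseteq> C \<inter> C'" using f UT C by blast
    moreover have "card (insert p T) = t" using pZ finT T(3) t_pos unfolding Z_def by simp
    ultimately have "insert p T = C \<inter> C'" using f(3) Ufin(1)[OF C(1)] by (intro card_subset_eq) auto
    moreover have "i \<notin> insert p T" "j \<notin> insert p T" using T pZ unfolding Z_def by auto
    ultimately have sd: "i \<in> C \<and> j \<notin> C \<and> j \<in> C' \<and> i \<notin> C' \<or> j \<in> C \<and> i \<notin> C \<and> i \<in> C' \<and> j \<notin> C'"
      using UT[OF C(1)] UT[OF C(2)] by blast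
    then have "Z \<subseteq> C \<union> C'" using UT[OF C(1)] unfolding Z_def by blast
    then have "C \<union> C' = W" using f(6) Ufin(3)[OF C(1)] Ufin(3)[OF C(2)] unfolding W by blast
    then have "card C + card C' = card W + t"
      using card_Un_Int[OF Ufin(1)[OF C(1)] Ufin(1)[OF C(2)]] f(3) by simp
    then show ?thesis using f sd by simp
  qed
  have cY: "k - t \<le> card Y"
  proof -
    have "card Y = n - (t + 1)" using Z unfolding Y_def by (simp add: card_Diff_subset)
    then show ?thesis using n_ge t_less by linarith
  qed
  have "finite Y" using Yn by (rule finite_subset) simp
  from exists_initial_segment[OF this cY] obtain S
    where S: "S \<subseteq> Y" "card S = k - t" and S': "\<forall>s\<in>S. \<forall>y\<in>Y - S. s < y"
    by (elim exE conjE)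
  have Sless: "s < y" if "s \<in> S" "y \<in> Y - S" for s y using S' that by (elim ballE) auto
  have finS: "finite S" using S(1) Yn by (meson finite_atLeastAtMost finite_subset)
  have side: "insert c T \<union> S \<in> \<F>"
    if cd: "c = i \<and> d = j \<or> c = j \<and> d = i" for c d
  proof -
    obtain A where A: "A \<in> \<F>" "c \<in> A" "d \<notin> A" using sides cd by blast
    have A': "A \<subseteq> {1..n}" "card A = k" "finite A" using admissibleD[OF adm A(1)] by auto
    have AY: "A - Y = insert c T" using A all[OF A(1)] A' cd unfolding Y_def Z_def by blast
    have "A \<inter> Y = A - insert c T" using AY by blast
    moreover have "insert c T \<subseteq> A" using A all by blast
    ultimately have "card (A \<inter> Y) = k - t"
      using A' one cd finT by (metis card_Diff_subset finite_insert)
    then have "(A - Y) \<union> S \<in> \<F>"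
      using A' S finS Sless by (intro stable_initial_segment[OF st subset_refl S(1) _ A(1)]) simp_all
    then show ?thesis unfolding AY .
  qed
  have pS: "Yp \<subseteq> S" if "p \<in> S"
  proof
    fix y assume y: "y \<in> Yp"
    then have "y \<in> Y" "y \<le> p" unfolding Yp_def by auto
    then show "y \<in> S" using Sless[OF that, of y] by (cases "y \<in> S") auto
  qed
  have SW: "S \<inter> W \<subseteq> Yp" using S(1) ZYp by blast
  \<comment> \<open>If \<open>Yp \<subseteq> S\<close>, the traces of \<open>insert i T \<union> S\<close> and \<open>insert j T \<union> S\<close> have \<open>card W - 1\<close> points; otherwise they avoid \<open>p\<close>.\<close>
  have keep: "nontrivial t (cylinder n k W ((U - D) \<union> D'))"
    if D: "\<And>C. C \<in> D \<Longrightarrow> p \<in> C \<and> card C = b \<and> \<not> Z \<subseteq> C" and b: "\<not> (Yp \<subseteq> S \<and> b = card W - 1)" for D D' b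
  proof (rule nontriv)
    fix A assume A: "A \<in> nsets {1..n} k" "Z \<subseteq> A"
    have "A \<inter> W \<in> U" using full[OF A] unfolding U_def traces_def by blast
    moreover have "A \<inter> W \<notin> D" using D[of "A \<inter> W"] A(2) unfolding W by blast
    ultimately show "A \<in> cylinder n k W ((U - D) \<union> D')" using A unfolding cylinder_def by blast
  next
    have mem: "insert c T \<union> S \<in> cylinder n k W ((U - D) \<union> D')"
      if cd: "c = i \<and> d = j \<or> c = j \<and> d = i" for c d
    proof -
      let ?R = "insert c T \<union> S"
      have R: "?R \<in> \<F>" using side[OF cd] .
      then have "?R \<inter> W \<in> U" unfolding U_def traces_def by blast
      moreover have "?R \<inter> W \<notin> D"
      proof
        assume RD: "?R \<inter> W \<in> D"
        have cT: "insert c T \<subseteq> Z" using cd unfolding Z_def by blast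
        have "p \<in> S" using D[OF RD] pZ cT by blast
        then have YS: "Yp \<subseteq> S" by (rule pS)
        then have "?R \<inter> W = insert c T \<union> Yp" using SW cT unfolding W by blast
        moreover have "card (insert c T \<union> Yp) = t + card Yp"
          using one[of c] cd finT finYp cT ZYp by (subst card_Un_disjoint) auto
        ultimately have "b = card W - 1" using D[OF RD] cW by simp
        then show False using b YS by blast
      qed
      moreover have "?R \<in> nsets {1..n} k" using R adm unfolding admissible_def by blast
      ultimately show ?thesis unfolding cylinder_def by blast
    qed
    have "j \<notin> insert i T \<union> S" "i \<notin> insert j T \<union> S"
      using ij T S(1) YZ unfolding Z_def by auto
    with mem[OF disjI1[OF conjI[OF refl refl]]] mem[OF disjI2[OF conjI[OF refl refl]]]
    show "\<exists>A\<in>cylinder n k W ((U - D) \<union> D'). j \<notin> A" "\<exists>A\<in>cylinder n k W ((U - D) \<union> D'). i \<notin> A"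
      by (metis (no_types))+
  qed
  \<comment> \<open>The roles of \<open>i\<close> and \<open>j\<close> are symmetric; \<open>c\<close> is the one in the trace of size \<open>t + 1\<close>.\<close>
  have core: ?thesis
    if cd: "c = i \<and> d = j \<or> c = j \<and> d = i" and C: "C \<in> U" "card C = t + 1" "p \<in> C" "c \<in> C" and YS: "Yp \<subseteq> S" for c d C
  proof (intro exI conjI)
    have Zcd: "Z = insert c (insert d T)" "c \<noteq> d" "c \<notin> T" "d \<notin> T" using cd ij T unfolding Z_def by auto
    have "card Yp \<le> k - t" using YS S(2) finS card_mono by metis
    moreover have "1 \<le> card Yp" using pp(1) finYp by (auto simp: Suc_le_eq card_gt_0_iff)
    moreover have d: "d \<notin> Yp" "c \<notin> Yp" using ZYp Zcd by auto
    moreover have "T \<inter> Yp = {}" using ZYp Zcd by blast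
    moreover have "insert c T \<subseteq> {1..n}" "insert d Yp \<subseteq> {1..n}" using Wn unfolding W Zcd(1) by auto
    moreover have cd': "c = i \<or> c = j" using cd by blast
    moreover note Zcd
    ultimately show "core_pair (insert c T) (insert d Yp)"
      using one finYp unfolding core_pair_def by simp
    have "insert p (insert c T) \<subseteq> C" using C UT by blast
    moreover have "card (insert p (insert c T)) = t + 1" using one[OF cd'] finT pZ Zcd by simp
    ultimately have Ceq: "insert p (insert c T) = C" using C(2) Ufin(1)[OF C(1)] by (intro card_subset_eq) auto
    have cs: "insert s (insert c T) \<in> U" if s: "s \<in> Yp" for s
    proof (cases "s = p")
      case False
      then have "s < p" using pp(2)[OF s] by simp
      moreover have "s \<notin> C" using s False ZYp Zcd Ceq by blast
      ultimately have "replace s p C \<in> U" using s pp(1) C by (intro stableD[OF stU]) auto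
      moreover have "C - {p} = insert c T" using Ceq pZ Zcd by blast
      ultimately show ?thesis unfolding replace_def by simp
    qed (use Ceq C in simp)
    have "(insert d T \<union> S) \<inter> W \<in> U" using side[of d c] cd unfolding U_def traces_def by blast
    moreover have "(insert d T \<union> S) \<inter> W = insert d T \<union> Yp" using SW YS Zcd unfolding W by blast
    ultimately have dY: "insert d T \<union> Yp \<in> U" by simp
    show "\<F> \<subseteq> core_family n k (insert c T) (insert d Yp)"
    proof
      fix A assume A: "A \<in> \<F>"
      have AU: "A \<inter> W \<in> U" using A unfolding U_def traces_def by blast
      have An: "A \<in> nsets {1..n} k" using A adm unfolding admissible_def by blast
      have AT: "T \<subseteq> A" "c \<in> A \<or> d \<in> A" using all[OF A] cd by auto
      show "A \<in> core_family n k (insert c T) (insert d Yp)"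
      proof (cases "c \<in> A")
        case True
        have "A \<inter> insert d Yp \<noteq> {}"
        proof
          assume e: "A \<inter> insert d Yp = {}"
          then have "(A \<inter> W) \<inter> (insert d T \<union> Yp) \<subseteq> T" by blast
          then have "card ((A \<inter> W) \<inter> (insert d T \<union> Yp)) \<le> card T" using finT by (intro card_mono)
          then show False using intersectingD[OF U AU dY] T(3) t_pos by simp
        qed
        then show ?thesis using True AT An unfolding core_family_def by blast
      next
        case False
        have "s \<in> A" if s: "s \<in> Yp" for s
        proof (rule ccontr)
          assume "s \<notin> A"
          then have "(A \<inter> W) \<inter> insert s (insert c T) \<subseteq> T" using False by blast
          then have "card ((A \<inter> W) \<inter> insert s (insert c T)) \<le> card T" using finT by (intro card_mono)
          then show False using intersectingD[OF U AU cs[OF s]] T(3) t_pos by simp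
        qed
        then have "insert d Yp \<subseteq> A" using False AT by blast
        moreover have "insert c T - A = {c}" using False AT by blast
        ultimately show ?thesis using An unfolding core_family_def by simp
      qed
    qed
  qed
  have "\<exists>E\<in>U. \<exists>E'\<in>U. card (E \<inter> E' - {p}) < t \<and> i \<in> E \<and> j \<notin> E \<and> j \<in> E' \<and> i \<notin> E'"
  proof -
    have E0U: "E0 \<in> U" "E0' \<in> U" using E0 unfolding U_def W_def by auto
    have "card (E0' \<inter> E0 - {p}) < t" using E0(3) by (simp add: Int_commute)
    then show ?thesis using conf[OF E0U E0(3)] E0U E0(3) by blast
  qed
  then obtain E E' where E: "E \<in> U" "E' \<in> U" "card (E \<inter> E' - {p}) < t" "i \<in> E" "j \<notin> E" "j \<in> E'" "i \<notin> E'"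
    by blast
  note cE = conf[OF E(1-3)]
  let ?X = "{C \<in> U. p \<in> C \<and> C - {p} \<notin> U \<and> card C = card E \<and> i \<in> C \<and> j \<notin> C}"
  let ?Y = "{C \<in> U. p \<in> C \<and> C - {p} \<notin> U \<and> card C = card E' \<and> j \<in> C \<and> i \<notin> C}"
  have "\<not> nontrivial t (cylinder n k W ((U - ?Y) \<union> (\<lambda>E. E - {p}) ` ?X)) \<or>
    \<not> nontrivial t (cylinder n k W ((U - ?X) \<union> (\<lambda>E. E - {p}) ` ?Y))"
  proof (rule trade_trivial[OF F Wn U_def U, of ?X p "card E" ?Y "card E'"])
    show "C' \<in> ?Y" if "C \<in> ?X" "C' \<in> U" "card (C \<inter> C' - {p}) < t" for C C'
      using conf[of C C'] that cE by auto
    show "C' \<in> ?X" if "C \<in> ?Y" "C' \<in> U" "card (C \<inter> C' - {p}) < t" for C C'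
      using conf[of C C'] that cE by auto
    show "?X \<noteq> {}" "?Y \<noteq> {}" using E cE by blast+
    show "card E + card E' = card W + t" using cE by blast
  qed blast+
  moreover have "nontrivial t (cylinder n k W ((U - ?Y) \<union> (\<lambda>E. E - {p}) ` ?X))"
    if "\<not> (Yp \<subseteq> S \<and> card E' = card W - 1)"
    using that by (intro keep[of _ "card E'"]) (auto simp: Z_def)
  moreover have "nontrivial t (cylinder n k W ((U - ?X) \<union> (\<lambda>E. E - {p}) ` ?Y))"
    if "\<not> (Yp \<subseteq> S \<and> card E = card W - 1)"
    using that by (intro keep[of _ "card E"]) (auto simp: Z_def)
  ultimately have "Yp \<subseteq> S \<and> card E' = card W - 1 \<or> Yp \<subseteq> S \<and> card E = card W - 1" by blast
  then show ?thesis
  proof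
    assume h: "Yp \<subseteq> S \<and> card E' = card W - 1"
    then have "card E = t + 1" using cE cW by simp
    then show ?thesis using core[of i j E] E cE h by blast
  next
    assume h: "Yp \<subseteq> S \<and> card E = card W - 1"
    then have "card E' = t + 1" using cE cW by simp
    then show ?thesis using core[of j i E'] E cE h by blast
  qed
qed

end

section \<open>The bound and its extremal families\<close>

context large_ground_set
begin

text \<open>Induction on the sum of all elements of all members, which every proper compression towards smaller
elements lowers. A compression that keeps the family nontrivial leads to another maximum family, and
the conclusion carries back by \<open>extremal_if_shift_extremal\<close>. Otherwise the family is stable under
all harmless compressions, and one of the two structural results places it in a core family.\<close>

lemma maximum_extremal: "maximum \<F> \<Longrightarrow> extremal \<F>"
proof (induction "\<Sum>A\<in>\<F>. \<Sum>A" arbitrary: \<F> rule: less_induct)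
  case less
  have adm: "admissible \<F>" using less.prems unfolding maximum_def by blast
  have ext: "extremal \<F>" if "core_pair T L" "\<F> \<subseteq> core_family n k T L" for T L
    using maximum_in_core_family[OF less.prems that(2,1)] that(1) unfolding extremal_def by blast
  show ?case
  proof (cases "\<exists>u\<in>{1..n}. \<exists>v\<in>{1..n}. u < v \<and> nontrivial t (shift u v \<F>) \<and> shift u v \<F> \<noteq> \<F>")
    case True
    then obtain u v where uv: "u \<in> {1..n}" "v \<in> {1..n}" "u < v" "nontrivial t (shift u v \<F>)" "shift u v \<F> \<noteq> \<F>"
      by blast
    have fin: "finite A" if "A \<in> \<F>" for A using admissibleD[OF adm that] by blast
    have "intersecting t (shift u v \<F>)"
      using adm uv(3) fin unfolding admissible_def by (intro shift_intersecting) auto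
    moreover have "shift u v \<F> \<subseteq> nsets {1..n} k"
      using adm uv(1) unfolding admissible_def by (intro shift_uniform) auto
    ultimately have "maximum (shift u v \<F>)"
      using less.prems uv(4) unfolding maximum_def admissible_def card_shift by blast
    moreover have "(\<Sum>A\<in>shift u v \<F>. \<Sum>A) < (\<Sum>A\<in>\<F>. \<Sum>A)"
      using admissible_finite[OF adm] fin uv(3,5) by (rule sum_shift_less)
    ultimately have "extremal (shift u v \<F>)" using less.hyps by blast
    then show ?thesis using extremal_if_shift_extremal[OF adm uv(1,2)] uv(3) by blast
  next
    case False
    then have fixed: "shift u v \<F> = \<F>"
      if "u \<in> {1..n}" "v \<in> {1..n}" "u < v" "nontrivial t (shift u v \<F>)" for u v
      using that by blast
    show ?thesis
    proof (cases "\<forall>u\<in>{1..n}. \<forall>v\<in>{1..n}. u < v \<longrightarrow> nontrivial t (shift u v \<F>)")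
      case True
      then have "stable {1..n} \<F>" using fixed by (intro stable_if_shift_eq) blast
      then show ?thesis using stable_maximum_in_core_family[OF less.prems] ext by blast
    next
      case False
      then obtain i j where ij: "i \<in> {1..n}" "j \<in> {1..n}" "i \<noteq> j" "\<not> nontrivial t (shift i j \<F>)" by blast
      obtain T where T: "i \<notin> T" "j \<notin> T" "card T = t - 1" "T \<subseteq> {1..n}"
        and all: "\<forall>A\<in>\<F>. T \<subseteq> A \<and> (i \<in> A \<or> j \<in> A)"
        and sides: "\<exists>A\<in>\<F>. i \<in> A \<and> j \<notin> A" "\<exists>A\<in>\<F>. j \<in> A \<and> i \<notin> A"
        using shift_trivial_structure[OF adm ij(3,4)] by (elim exE conjE)
      have all': "T \<subseteq> A \<and> (i \<in> A \<or> j \<in> A)" if "A \<in> \<F>" for A using all that by blast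
      show ?thesis
        using hinged_maximum_in_core_family[OF less.prems ij(3,1,2) T all' sides fixed] ext by blast
    qed
  qed
qed

lemma exists_maximum: "admissible \<F> \<Longrightarrow> \<exists>\<G>. maximum \<G> \<and> card \<F> \<le> card \<G>"
proof -
  assume F: "admissible \<F>"
  have "finite {\<G>. admissible \<G>}"
    by (rule finite_subset[OF _ finite_Pow_iff[THEN iffD2, OF finite_nsets_interval]])
      (auto simp: admissible_def)
  then have fin: "finite (card ` {\<G>. admissible \<G>})" by (rule finite_imageI)
  moreover have "card ` {\<G>. admissible \<G>} \<noteq> {}" using F by blast
  ultimately have "Max (card ` {\<G>. admissible \<G>}) \<in> card ` {\<G>. admissible \<G>}" by (rule Max_in)
  then obtain \<G> where G: "admissible \<G>" "card \<G> = Max (card ` {\<G>. admissible \<G>})" by auto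
  have "card \<H> \<le> card \<G>" if "admissible \<H>" for \<H>
    unfolding G(2) using that by (intro Max_ge[OF fin]) blast
  then show ?thesis using F G(1) unfolding maximum_def by blast
qed

lemma exists_permutation_of_core_pair:
  assumes "core_pair T L" "core_pair T' L'" "card L = card L'"
  shows "\<exists>\<pi>. \<pi> permutes {1..n} \<and> \<pi> ` T = T' \<and> \<pi> ` L = L'"
proof -
  have fin: "finite T" "finite L" "finite T'" "finite L'" using core_pair_finite assms by auto
  have p: "T \<subseteq> {1..n}" "L \<subseteq> {1..n}" "T \<inter> L = {}" "T' \<subseteq> {1..n}" "L' \<subseteq> {1..n}" "T' \<inter> L' = {}" "card T = card T'"
    using assms unfolding core_pair_def by auto
  let ?R = "{1..n} - (T \<union> L)" and ?R' = "{1..n} - (T' \<union> L')"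
  have "card (T \<union> L) = card (T' \<union> L')" using fin p assms(3) by (simp add: card_Un_disjoint)
  then have cR: "card ?R = card ?R'" using fin p by (simp add: card_Diff_subset)
  obtain f where f: "bij_betw f T T'" using finite_same_card_bij[OF fin(1,3) p(7)] by blast
  obtain g where g: "bij_betw g L L'" using finite_same_card_bij[OF fin(2,4) assms(3)] by blast
  obtain h where h: "bij_betw h ?R ?R'" using finite_same_card_bij[OF _ _ cR] by auto
  define \<pi> where "\<pi> x = (if x \<in> T then f x else if x \<in> L then g x else if x \<in> ?R then h x else x)" for x
  have 1: "bij_betw \<pi> T T'" using f by (rule bij_betw_cong[THEN iffD1, rotated]) (simp add: \<pi>_def)
  have 2: "bij_betw \<pi> L L'" using g p(3) by (subst bij_betw_cong[of L \<pi> g]) (auto simp: \<pi>_def)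
  have 3: "bij_betw \<pi> ?R ?R'" using h by (subst bij_betw_cong[of ?R \<pi> h]) (auto simp: \<pi>_def)
  have "bij_betw \<pi> (T \<union> L) (T' \<union> L')" using 1 2 p(6) by (rule bij_betw_combine)
  then have "bij_betw \<pi> ((T \<union> L) \<union> ?R) ((T' \<union> L') \<union> ?R')" using 3 by (rule bij_betw_combine) blast
  moreover have "(T \<union> L) \<union> ?R = {1..n}" "(T' \<union> L') \<union> ?R' = {1..n}" using p by auto
  ultimately have "bij_betw \<pi> {1..n} {1..n}" by simp
  then have "\<pi> permutes {1..n}" using p by (intro bij_imp_permutes) (auto simp: \<pi>_def)
  then show ?thesis using 1 2 unfolding bij_betw_def by blast
qed

lemma core_family_standard_A:
  "core_pair {1..t} {t + 1..t + 2}" "family_A n k (t + 1) = core_family n k {1..t} {t + 1..t + 2}"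
proof -
  show cp: "core_pair {1..t} {t + 1..t + 2}"
    using t_pos t_less n_ge unfolding core_pair_def by auto
  have un: "{1..t} \<union> {t + 1..t + 2} = {1..t + 2}" by auto
  have "t + 1 \<le> card (A \<inter> {1..t + 2}) \<longleftrightarrow> card ({1..t + 2} - A) \<le> 1" for A
  proof -
    have "t + 2 = card ({1..t + 2} \<inter> A) + card ({1..t + 2} - A)"
      by (metis card_Int_Diff card_atLeastAtMost diff_Suc_1 finite_atLeastAtMost)
    then show ?thesis by (auto simp: Int_commute)
  qed
  moreover have "card {t + 1..t + 2} = 2" by simp
  ultimately show "family_A n k (t + 1) = core_family n k {1..t} {t + 1..t + 2}"
    using core_family_two[OF cp] unfolding family_A_def un by (simp add: add.assoc)
qed

lemma core_family_standard_H:
  "core_pair {1..t} {t + 1..k + 1}" "family_H n k (t + 1) = core_family n k {1..t} {t + 1..k + 1}"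
proof -
  show cp: "core_pair {1..t} {t + 1..k + 1}"
    using t_pos t_less n_ge unfolding core_pair_def by auto
  have un: "{1..t} \<union> {t + 1..k + 1} = {1..k + 1}" using t_less by auto
  have "card {t + 1..k + 1} = k - t + 1" using t_less by simp
  note core = core_family_large(1)[OF cp this]
  have "{{1..k + 1} - {i} |i. i \<in> {1..t}} = (\<lambda>x. {1..k + 1} - {x}) ` {1..t}" by blast
  then show "family_H n k (t + 1) = core_family n k {1..t} {t + 1..k + 1}"
    unfolding family_H_def core un by simp
qed

lemma extremal_isomorphic:
  assumes "extremal \<F>"
  shows "isomorphic_families n \<F> (family_A n k (t + 1)) \<or> isomorphic_families n \<F> (family_H n k (t + 1))"
proof -
  obtain T L where TL: "core_pair T L" "card L = 2 \<or> card L = k - t + 1" "\<F> = core_family n k T L"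
    using assms unfolding extremal_def by blast
  have iso: "isomorphic_families n \<F> (core_family n k T' L')" if "core_pair T' L'" "card L' = card L" for T' L'
    using exists_permutation_of_core_pair[OF that(1) TL(1) that(2)] core_family_image[of _ T' L']
    unfolding isomorphic_families_def TL(3) by metis
  have "card {t + 1..t + 2} = 2" "card {t + 1..k + 1} = k - t + 1" using t_less by simp_all
  then show ?thesis
    using TL(2) iso[OF core_family_standard_A(1)] iso[OF core_family_standard_H(1)]
    unfolding core_family_standard_A(2) core_family_standard_H(2) by metis
qed

lemma card_isomorphic: "isomorphic_families n \<F> \<G> \<Longrightarrow> card \<F> = card \<G>"
proof -
  assume "isomorphic_families n \<F> \<G>"
  then obtain \<pi> where p: "\<pi> permutes {1..n}" "\<F> = (\<lambda>A. \<pi> ` A) ` \<G>" unfolding isomorphic_families_def by blast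
  have "inj_on (\<lambda>A. \<pi> ` A) \<G>"
    using permutes_inj[OF p(1)] by (intro inj_onI) (simp add: inj_image_eq_iff)
  then show ?thesis unfolding p(2) by (rule card_image)
qed

theorem nontrivial_intersecting_bound:
  assumes F: "admissible \<F>"
  defines "m \<equiv> max (card (family_H n k (t + 1))) (card (family_A n k (t + 1)))"
  shows "card \<F> \<le> m"
    and "card \<F> = m \<Longrightarrow>
      isomorphic_families n \<F> (family_A n k (t + 1)) \<or> isomorphic_families n \<F> (family_H n k (t + 1))"
proof -
  have le: "card \<G> \<le> m" if "maximum \<G>" for \<G>
    using extremal_isomorphic[OF maximum_extremal[OF that]] card_isomorphic[of \<G>] unfolding m_def by fastforce
  obtain \<G> where G: "maximum \<G>" "card \<F> \<le> card \<G>" using exists_maximum[OF F] by blast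
  then show "card \<F> \<le> m" using le by (meson le_trans)
  assume "card \<F> = m"
  then have "card \<F> = card \<G>" using le[OF G(1)] G(2) by simp
  then have "maximum \<F>" using F G(1) unfolding maximum_def by simp
  then show "isomorphic_families n \<F> (family_A n k (t + 1)) \<or> isomorphic_families n \<F> (family_H n k (t + 1))"
    by (rule extremal_isomorphic[OF maximum_extremal])
qed

end

text \<open>Starting from two members, a further member that does not contain the present intersection removes
a point from it. Such a member exists as long as at least \<open>t\<close> points are left. The second alternative
of the auxiliary claim records that the intersection has already become smaller than \<open>t\<close>.\<close>

lemma wise_intersecting_imp_pairwise:
  assumes nt: "nontrivial_wise_intersecting n d t \<F>" and d: "2 \<le> d" and F: "\<F> \<subseteq> nsets {1..n} k"
  shows "intersecting (t + d - 2) \<F>"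
  unfolding intersecting_def
proof (intro ballI, rule ccontr)
  fix A B assume AB: "A \<in> \<F>" "B \<in> \<F>" and "\<not> t + d - 2 \<le> card (A \<inter> B)"
  then have small: "card (A \<inter> B) < t + (d - 2)" using d by simp
  have fin: "finite C" "C \<subseteq> {1..n}" if "C \<in> \<F>" for C using that F unfolding nsets_def by auto
  have chain: "\<exists>f. (\<forall>i\<in>{1..Suc (Suc e)}. f i \<in> \<F>) \<and> (card (\<Inter>i\<in>{1..Suc (Suc e)}. f i) + e \<le> card (A \<inter> B)
      \<or> card (\<Inter>i\<in>{1..Suc (Suc e)}. f i) < t)" for e
  proof (induction e)
    case 0
    have "{1..Suc (Suc 0)} = {1::nat, 2}" by auto
    then show ?case using AB
      by (intro exI[of _ "\<lambda>i. if i = 1 then A else B"]) (simp add: Int_commute)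
  next
    case (Suc e)
    then obtain f where f: "\<forall>i\<in>{1..Suc (Suc e)}. f i \<in> \<F>" and
      c: "card (\<Inter>i\<in>{1..Suc (Suc e)}. f i) + e \<le> card (A \<inter> B) \<or> card (\<Inter>i\<in>{1..Suc (Suc e)}. f i) < t" by blast
    let ?X = "\<Inter>i\<in>{1..Suc (Suc e)}. f i"
    have X1: "?X \<subseteq> f 1" "f 1 \<in> \<F>" using f by auto
    then have finX: "finite ?X" "?X \<subseteq> {1..n}" using fin[OF X1(2)] finite_subset by blast+
    have ext: "(\<forall>i\<in>{1..Suc (Suc (Suc e))}. (f(Suc (Suc (Suc e)) := C)) i \<in> \<F>) \<and>
      (\<Inter>i\<in>{1..Suc (Suc (Suc e))}. (f(Suc (Suc (Suc e)) := C)) i) = C \<inter> ?X" if "C \<in> \<F>" for C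
      using f that by (auto simp: atLeastAtMostSuc_conv)
    show ?case
    proof (cases "card ?X < t")
      case True
      have "card (A \<inter> ?X) \<le> card ?X" using finX by (intro card_mono) auto
      then show ?thesis using True ext[OF AB(1)] by (intro exI[of _ "f(Suc (Suc (Suc e)) := A)"]) simp
    next
      case False
      have "\<exists>C\<in>\<F>. \<not> ?X \<subseteq> C"
      proof (rule ccontr)
        assume "\<not> ?thesis"
        then have "?X \<subseteq> {1..n} \<inter> \<Inter>\<F>" using finX by blast
        then have "card ?X \<le> card ({1..n} \<inter> \<Inter>\<F>)" by (intro card_mono) auto
        then show False using False nt unfolding nontrivial_wise_intersecting_def by simp
      qed
      then obtain C where C: "C \<in> \<F>" "\<not> ?X \<subseteq> C" by blast
      have "card (C \<inter> ?X) < card ?X" using C(2) finX by (intro psubset_card_mono) auto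
      then have "card (C \<inter> ?X) + Suc e \<le> card (A \<inter> B)" using c False by simp
      then show ?thesis using ext[OF C(1)] by (intro exI[of _ "f(Suc (Suc (Suc e)) := C)"]) simp
    qed
  qed
  have dd: "Suc (Suc (d - 2)) = d" using d by simp
  from chain[of "d - 2", unfolded dd] obtain f where f: "\<forall>i\<in>{1..d}. f i \<in> \<F>"
    "card (\<Inter>i\<in>{1..d}. f i) + (d - 2) \<le> card (A \<inter> B) \<or> card (\<Inter>i\<in>{1..d}. f i) < t"
    by blast
  have "t \<le> card (\<Inter>i\<in>{1..d}. f i)"
    using nt f(1) unfolding nontrivial_wise_intersecting_def wise_intersecting_def by blast
  then show False using f(2) small by linarith
qed

theorem theorem4:
  fixes n k d t :: nat and \<F> :: "nat set set"
  assumes "d \<ge> 2" and "t \<ge> 1" and "k \<ge> t + d - 1"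
    and "real n > (real t + real d + 1) / 2 * (real k - real t - real d + 3)"
    and "\<F> \<subseteq> nsets {1..n} k"
    and "nontrivial_wise_intersecting n d t \<F>"
  shows "card \<F> \<le> max (card (family_H n k (t + d - 1))) (card (family_A n k (t + d - 1)))
    \<and> (card \<F> = max (card (family_H n k (t + d - 1))) (card (family_A n k (t + d - 1))) \<longrightarrow>
         isomorphic_families n \<F> (family_A n k (t + d - 1)) \<or>
         isomorphic_families n \<F> (family_H n k (t + d - 1)))"
proof -
  define s where "s = t + d - 2"
  have s: "t + d - 1 = s + 1" "s < k" "1 \<le> s" "t \<le> s" using assms(1-3) unfolding s_def by auto
  have "real ((s + 3) * (k - s + 1)) < real (2 * n)"
  proof -
    have "real (s + 3) = real t + real d + 1" "real (k - s + 1) = real k - real t - real d + 3"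
      using assms(1) s unfolding s_def by auto
    then have "real ((s + 3) * (k - s + 1)) = (real t + real d + 1) * (real k - real t - real d + 3)"
      by (simp only: of_nat_mult)
    also have "\<dots> < 2 * real n" using assms(4) by (simp add: field_simps)
    finally show ?thesis by simp
  qed
  then have "(s + 3) * (k - s + 1) < 2 * n" by (simp only: of_nat_less_iff)
  then interpret large_ground_set n k s using s by unfold_locales
  have "nontrivial s \<F>"
    unfolding nontrivial_def
  proof
    assume "\<exists>T. card T = s \<and> (\<forall>A\<in>\<F>. T \<subseteq> A)"
    then obtain T where T: "card T = s" "\<forall>A\<in>\<F>. T \<subseteq> A" by blast
    have small: "card ({1..n} \<inter> \<Inter>\<F>) < t" using assms(6) unfolding nontrivial_wise_intersecting_def by blast
    show False
    proof (cases "\<F> = {}")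
      case True
      then show False using small s n_ge by simp
    next
      case False
      then have "T \<subseteq> {1..n} \<inter> \<Inter>\<F>" using T(2) assms(5) unfolding nsets_def by blast
      then have "s \<le> card ({1..n} \<inter> \<Inter>\<F>)" using T(1) by (metis card_mono finite_Int finite_atLeastAtMost)
      then show False using small s by simp
    qed
  qed
  moreover have "intersecting s \<F>"
    using wise_intersecting_imp_pairwise[OF assms(6,1,5)] unfolding s_def .
  ultimately have "admissible \<F>" using assms(5) unfolding admissible_def by blast
  then show ?thesis using nontrivial_intersecting_bound unfolding s(1) by blast
qed

end
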